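(* Let $W\subseteq V$ be two (transitive) models of ZFC. Suppose that in $V$ there is a perfect set $P\subseteq 2^\omega$ all of whose elements belong to $W$. If $(W,V)$ satisfies the countable covering property for the reals, then $\mathbb{R}^W=\mathbb{R}^V$.
   Context: For models $W\subseteq V$ of set theory, the pair $(W,V)$ satisfies the countable covering property for the reals if for every $X\in V$ with $X\subseteq\mathbb{R}^W$ and $X$ countable in $V$ there is $Y\in W$ with $X\subseteq Y$ and $Y$ countable in $W$. $\mathbb{R}^M$ denotes the set of reals of the model $M$. *)

theory Defs
  imports Main
begin

text \<open>First-order formulas in the language of set theory, with de Bruijn indices.\<close>

datatype fm =
    Member nat nat
  | Equal nat nat
  | Neg fm
  | Conj fm fm
  | Forall fm

text \<open>The background universe in which transitive models live: an extensional and
  well-founded membership relation. No set existence axioms are assumed of the background;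
  every transitive set or class with the true membership relation gives such a structure.
  Collections of type \<^typ>\<open>'u set\<close> play the role of (possibly proper) classes.\<close>

locale set_universe =
  fixes mem :: "'u \<Rightarrow> 'u \<Rightarrow> bool"  (infix "\<^bold>\<in>" 50)
  assumes extensional: "(\<And>z. z \<^bold>\<in> x \<longleftrightarrow> z \<^bold>\<in> y) \<Longrightarrow> x = y"
    and wellfounded: "wfP mem"
begin

definition elems :: "'u \<Rightarrow> 'u set" where
  "elems x = {z. z \<^bold>\<in> x}"

definition transitive :: "'u set \<Rightarrow> bool" where
  "transitive M \<longleftrightarrow> (\<forall>x\<in>M. elems x \<subseteq> M)"

primrec sat :: "'u set \<Rightarrow> (nat \<Rightarrow> 'u) \<Rightarrow> fm \<Rightarrow> bool" where
  "sat M e (Member i j) \<longleftrightarrow> e i \<^bold>\<in> e j"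
| "sat M e (Equal i j) \<longleftrightarrow> e i = e j"
| "sat M e (Neg p) \<longleftrightarrow> \<not> sat M e p"
| "sat M e (Conj p q) \<longleftrightarrow> sat M e p \<and> sat M e q"
| "sat M e (Forall p) \<longleftrightarrow> (\<forall>x\<in>M. sat M (case_nat x e) p)"

text \<open>In the definitions below, the first argument \<open>M\<close> is the model in which a notion is
  interpreted: each is a first-order formula about membership, with all its quantifiers
  relativized to \<open>M\<close>.\<close>

definition is_subset :: "'u set \<Rightarrow> 'u \<Rightarrow> 'u \<Rightarrow> bool" where
  "is_subset M x y \<longleftrightarrow> (\<forall>z\<in>M. z \<^bold>\<in> x \<longrightarrow> z \<^bold>\<in> y)"

definition is_empty :: "'u set \<Rightarrow> 'u \<Rightarrow> bool" where
  "is_empty M x \<longleftrightarrow> (\<forall>z\<in>M. \<not> z \<^bold>\<in> x)"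

definition is_upair :: "'u set \<Rightarrow> 'u \<Rightarrow> 'u \<Rightarrow> 'u \<Rightarrow> bool" where
  "is_upair M a b p \<longleftrightarrow> (\<forall>z\<in>M. z \<^bold>\<in> p \<longleftrightarrow> z = a \<or> z = b)"

text \<open>Kuratowski pairs.\<close>

definition is_pair :: "'u set \<Rightarrow> 'u \<Rightarrow> 'u \<Rightarrow> 'u \<Rightarrow> bool" where
  "is_pair M a b p \<longleftrightarrow>
     (\<exists>s\<in>M. \<exists>d\<in>M. is_upair M a a s \<and> is_upair M a b d \<and> is_upair M s d p)"

definition is_succ :: "'u set \<Rightarrow> 'u \<Rightarrow> 'u \<Rightarrow> bool" where
  "is_succ M x y \<longleftrightarrow> (\<forall>z\<in>M. z \<^bold>\<in> y \<longleftrightarrow> z \<^bold>\<in> x \<or> z = x)"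

definition is_inductive :: "'u set \<Rightarrow> 'u \<Rightarrow> bool" where
  "is_inductive M i \<longleftrightarrow>
     (\<exists>z\<in>M. is_empty M z \<and> z \<^bold>\<in> i) \<and>
     (\<forall>x\<in>M. x \<^bold>\<in> i \<longrightarrow> (\<exists>y\<in>M. is_succ M x y \<and> y \<^bold>\<in> i))"


definition extensionality_ax :: "'u set \<Rightarrow> bool" where
  "extensionality_ax M \<longleftrightarrow>
     (\<forall>x\<in>M. \<forall>y\<in>M. (\<forall>z\<in>M. z \<^bold>\<in> x \<longleftrightarrow> z \<^bold>\<in> y) \<longrightarrow> x = y)"

definition foundation_ax :: "'u set \<Rightarrow> bool" where
  "foundation_ax M \<longleftrightarrow>
     (\<forall>x\<in>M. \<not> is_empty M x \<longrightarrow>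
        (\<exists>y\<in>M. y \<^bold>\<in> x \<and> (\<forall>z\<in>M. z \<^bold>\<in> y \<longrightarrow> \<not> z \<^bold>\<in> x)))"

definition pairing_ax :: "'u set \<Rightarrow> bool" where
  "pairing_ax M \<longleftrightarrow> (\<forall>a\<in>M. \<forall>b\<in>M. \<exists>p\<in>M. is_upair M a b p)"

definition union_ax :: "'u set \<Rightarrow> bool" where
  "union_ax M \<longleftrightarrow>
     (\<forall>x\<in>M. \<exists>u\<in>M. \<forall>z\<in>M. z \<^bold>\<in> u \<longleftrightarrow> (\<exists>y\<in>M. y \<^bold>\<in> x \<and> z \<^bold>\<in> y))"

definition powerset_ax :: "'u set \<Rightarrow> bool" where
  "powerset_ax M \<longleftrightarrow> (\<forall>x\<in>M. \<exists>p\<in>M. \<forall>y\<in>M. y \<^bold>\<in> p \<longleftrightarrow> is_subset M y x)"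

definition infinity_ax :: "'u set \<Rightarrow> bool" where
  "infinity_ax M \<longleftrightarrow> (\<exists>i\<in>M. is_inductive M i)"

text \<open>In the two schemes, the assignment \<open>e\<close> supplies parameters from \<open>M\<close>.\<close>

definition separation_ax :: "'u set \<Rightarrow> bool" where
  "separation_ax M \<longleftrightarrow>
     (\<forall>p e. range e \<subseteq> M \<longrightarrow>
        (\<forall>x\<in>M. \<exists>y\<in>M. \<forall>z\<in>M. z \<^bold>\<in> y \<longleftrightarrow> z \<^bold>\<in> x \<and> sat M (case_nat z e) p))"

definition replacement_ax :: "'u set \<Rightarrow> bool" where
  "replacement_ax M \<longleftrightarrow>
     (\<forall>p e. range e \<subseteq> M \<longrightarrow>
        (\<forall>x\<in>M.
           (\<forall>a\<in>M. a \<^bold>\<in> x \<longrightarrow> (\<exists>!b. b \<in> M \<and> sat M (case_nat a (case_nat b e)) p)) \<longrightarrow>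
           (\<exists>y\<in>M. \<forall>b\<in>M. b \<^bold>\<in> y \<longleftrightarrow>
              (\<exists>a\<in>M. a \<^bold>\<in> x \<and> sat M (case_nat a (case_nat b e)) p))))"

definition choice_ax :: "'u set \<Rightarrow> bool" where
  "choice_ax M \<longleftrightarrow>
     (\<forall>x\<in>M.
        (\<forall>a\<in>M. a \<^bold>\<in> x \<longrightarrow> \<not> is_empty M a) \<and>
        (\<forall>a\<in>M. \<forall>b\<in>M. a \<^bold>\<in> x \<and> b \<^bold>\<in> x \<and> a \<noteq> b \<longrightarrow> \<not> (\<exists>z\<in>M. z \<^bold>\<in> a \<and> z \<^bold>\<in> b)) \<longrightarrow>
        (\<exists>c\<in>M. \<forall>a\<in>M. a \<^bold>\<in> x \<longrightarrow> (\<exists>!z. z \<in> M \<and> z \<^bold>\<in> a \<and> z \<^bold>\<in> c)))"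

definition ZFC_model :: "'u set \<Rightarrow> bool" where
  "ZFC_model M \<longleftrightarrow>
     extensionality_ax M \<and> foundation_ax M \<and> pairing_ax M \<and> union_ax M \<and> powerset_ax M \<and>
     infinity_ax M \<and> separation_ax M \<and> replacement_ax M \<and> choice_ax M"


definition is_omega :: "'u set \<Rightarrow> 'u \<Rightarrow> bool" where
  "is_omega M w \<longleftrightarrow>
     is_inductive M w \<and> (\<forall>i\<in>M. is_inductive M i \<longrightarrow> is_subset M w i)"

definition is_two :: "'u set \<Rightarrow> 'u \<Rightarrow> bool" where
  "is_two M t \<longleftrightarrow> (\<exists>z\<in>M. \<exists>u\<in>M. is_empty M z \<and> is_succ M z u \<and> is_succ M u t)"

definition maps_to :: "'u set \<Rightarrow> 'u \<Rightarrow> 'u \<Rightarrow> 'u \<Rightarrow> bool" where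
  "maps_to M f a b \<longleftrightarrow> (\<exists>p\<in>M. p \<^bold>\<in> f \<and> is_pair M a b p)"

definition is_function :: "'u set \<Rightarrow> 'u \<Rightarrow> 'u \<Rightarrow> 'u \<Rightarrow> bool" where
  "is_function M f A B \<longleftrightarrow>
     (\<forall>p\<in>M. p \<^bold>\<in> f \<longrightarrow> (\<exists>a\<in>M. \<exists>b\<in>M. a \<^bold>\<in> A \<and> b \<^bold>\<in> B \<and> is_pair M a b p)) \<and>
     (\<forall>a\<in>M. a \<^bold>\<in> A \<longrightarrow> (\<exists>!b. b \<in> M \<and> maps_to M f a b))"

definition is_injection :: "'u set \<Rightarrow> 'u \<Rightarrow> 'u \<Rightarrow> 'u \<Rightarrow> bool" where
  "is_injection M f A B \<longleftrightarrow>
     is_function M f A B \<and>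
     (\<forall>a\<in>M. \<forall>a'\<in>M. \<forall>b\<in>M. maps_to M f a b \<and> maps_to M f a' b \<longrightarrow> a = a')"

definition countable_in :: "'u set \<Rightarrow> 'u \<Rightarrow> bool" where
  "countable_in M X \<longleftrightarrow> (\<exists>w\<in>M. \<exists>f\<in>M. is_omega M w \<and> is_injection M f X w)"

text \<open>The reals of \<open>M\<close> are the points of the Cantor space as computed in \<open>M\<close>.\<close>

definition reals :: "'u set \<Rightarrow> 'u set" where
  "reals M = {x \<in> M. \<exists>w\<in>M. \<exists>t\<in>M. is_omega M w \<and> is_two M t \<and> is_function M x w t}"

text \<open>\<open>agree_below M n x y\<close>: \<open>x\<close> and \<open>y\<close> have the same restriction to the natural number
  \<open>n\<close> (a von Neumann ordinal), i.e. \<open>y\<close> lies in the basic open neighbourhood of \<open>x\<close>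
  determined by its first \<open>n\<close> values.\<close>

definition agree_below :: "'u set \<Rightarrow> 'u \<Rightarrow> 'u \<Rightarrow> 'u \<Rightarrow> bool" where
  "agree_below M n x y \<longleftrightarrow>
     (\<forall>k\<in>M. k \<^bold>\<in> n \<longrightarrow> (\<exists>v\<in>M. maps_to M x k v \<and> maps_to M y k v))"

text \<open>In \<open>M\<close>, \<open>P\<close> is a perfect subset of the Cantor space: nonempty, closed, and without
  isolated points.\<close>

definition perfect_in :: "'u set \<Rightarrow> 'u \<Rightarrow> bool" where
  "perfect_in M P \<longleftrightarrow>
     (\<forall>x\<in>M. x \<^bold>\<in> P \<longrightarrow> x \<in> reals M) \<and>
     (\<exists>x\<in>M. x \<^bold>\<in> P) \<and>
     (\<exists>w\<in>M. is_omega M w \<and>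
        (\<forall>x\<in>reals M.
           (\<forall>n\<in>M. n \<^bold>\<in> w \<longrightarrow> (\<exists>y\<in>M. y \<^bold>\<in> P \<and> agree_below M n x y)) \<longrightarrow> x \<^bold>\<in> P) \<and>
        (\<forall>x\<in>M. x \<^bold>\<in> P \<longrightarrow>
           (\<forall>n\<in>M. n \<^bold>\<in> w \<longrightarrow> (\<exists>y\<in>M. y \<^bold>\<in> P \<and> y \<noteq> x \<and> agree_below M n x y))))"

definition countable_covering_reals :: "'u set \<Rightarrow> 'u set \<Rightarrow> bool" where
  "countable_covering_reals W V \<longleftrightarrow>
     (\<forall>X\<in>V. elems X \<subseteq> reals W \<and> countable_in V X \<longrightarrow>
        (\<exists>Y\<in>W. elems X \<subseteq> elems Y \<and> countable_in W Y))"

end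

end

theory Submission
  imports Defs "HOL-Library.Nat_Bijection"
begin

text \<open>By covering, \<open>W\<close> contains a sequence \<open>y\<close> of reals that is dense in the perfect set \<open>P\<close>: cover the
  countable set of eventually leftmost branches of \<open>P\<close>. A point \<open>x\<close> of \<open>P\<close> can be built in \<open>V\<close> by
  following some term of \<open>y\<close> that lies in \<open>P\<close>, leaving it at a level where \<open>P\<close> branches, following another
  such term, and so on; since \<open>x\<close> belongs to \<open>W\<close>, so does the record of how long \<open>x\<close> follows each term.
  Playing two such points against each other shows that every function from \<open>\<omega>\<close> to \<open>\<omega>\<close> in \<open>V\<close> is
  dominated by one in \<open>W\<close>. With dominating functions at hand, \<open>W\<close> can recognize which terms \<open>x\<close> really
  followed and whether it left them early or late, and a sequence of such choices codes any given
  real of \<open>V\<close>.\<close>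

section \<open>Definability over a transitive model\<close>

text \<open>The obstacle is that \<open>P\<close> itself need not belong to \<open>W\<close>:
  \<open>W\<close> owns the points of \<open>P\<close> one at a time and the sequence
  \<open>yy\<close>, but may be unable to tell which terms lie in \<open>P\<close>. Information
  therefore enters \<open>W\<close> only through single points: a recursion in \<open>V\<close>
  produces a limit of points of \<open>P\<close>, closedness puts the limit into \<open>P\<close>
  and thereby into \<open>W\<close>. One point does not suffice for domination. What
  \<open>W\<close> reads off at an index \<open>k\<close> exceeds the waiting time at the last
  followed index up to \<open>k\<close>; but that time is fixed before the next followed index is
  known, so it cannot be chosen above the given function there. Two points remove the circularity,
  each waiting according to the position already reached by the other. Domination is then used
  twice: for the levels from which the closed set \<open>P\<close> excludes terms outside it, and
  for the levels of the earliest departures. Both are computed from \<open>P\<close>, hence only in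
  \<open>V\<close>, but upper bounds in \<open>W\<close> serve equally well.\<close>

primrec rename_fm :: "(nat \<Rightarrow> nat) \<Rightarrow> fm \<Rightarrow> fm" where
  "rename_fm \<rho> (Member i j) = Member (\<rho> i) (\<rho> j)"
| "rename_fm \<rho> (Equal i j) = Equal (\<rho> i) (\<rho> j)"
| "rename_fm \<rho> (Neg p) = Neg (rename_fm \<rho> p)"
| "rename_fm \<rho> (Conj p q) = Conj (rename_fm \<rho> p) (rename_fm \<rho> q)"
| "rename_fm \<rho> (Forall p) = Forall (rename_fm (case_nat 0 (Suc \<circ> \<rho>)) p)"

text \<open>Even indices hold the variables of a definable predicate, odd ones its parameters; thus
  parameters of several formulas can be combined by renaming variables.\<close>

definition merge :: "(nat \<Rightarrow> 'a) \<Rightarrow> (nat \<Rightarrow> 'a) \<Rightarrow> nat \<Rightarrow> 'a" where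
  "merge a e i = (if even i then a (i div 2) else e (i div 2))"

lemma merge_simps [simp]: "merge a e (2 * i) = a i" "merge a e (Suc (2 * i)) = e i"
  by (simp_all add: merge_def)

lemma range_merge: "range (merge a e) = range a \<union> range e"
proof
  show "range a \<union> range e \<subseteq> range (merge a e)"
  proof
    fix z assume "z \<in> range a \<union> range e"
    then obtain i where "z = merge a e (2 * i) \<or> z = merge a e (Suc (2 * i))"
      unfolding merge_simps by blast
    then show "z \<in> range (merge a e)" by blast
  qed
qed (auto simp: merge_def)

context set_universe
begin

lemma sat_rename: "sat M e (rename_fm \<rho> p) \<longleftrightarrow> sat M (e \<circ> \<rho>) p"
proof (induction p arbitrary: e \<rho>)
  case (Forall p)
  have "case_nat x e \<circ> case_nat 0 (Suc \<circ> \<rho>) = case_nat x (e \<circ> \<rho>)" for x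
    by (auto split: nat.split)
  then show ?case by (simp only: rename_fm.simps sat.simps Forall)
qed simp_all

lemma elems_inject: "elems x = elems y \<longleftrightarrow> x = y"
  using extensional[of x y] by (auto simp: elems_def set_eq_iff)

lemma mem_irrefl: "\<not> x \<^bold>\<in> x"
  using wellfounded by (metis wfp_def wf_not_refl mem_Collect_eq case_prod_conv)

text \<open>Unspecified unless \<open>A\<close> is the extension of some element; in a transitive model this is what
  \<open>represented A\<close> below guarantees.\<close>

definition cod :: "'u set \<Rightarrow> 'u" where
  "cod A = (THE x. elems x = A)"

lemma cod_elems [simp]: "cod (elems x) = x"
  by (simp add: cod_def elems_inject)

primrec num :: "nat \<Rightarrow> 'u" where
  "num 0 = cod {}"
| "num (Suc n) = cod (insert (num n) (elems (num n)))"

declare num.simps [simp del]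

text \<open>Off the numerals the value is 0, so \<open>numof\<close> maps every model onto the
  naturals and a quantifier over \<open>nat\<close> becomes a quantifier over the whole
  model.\<close>

definition numof :: "'u \<Rightarrow> nat" where
  "numof x = (if x \<in> range num then inv num x else 0)"

definition pair :: "'u \<Rightarrow> 'u \<Rightarrow> 'u" where
  "pair a b = cod {cod {a}, cod {a, b}}"

text \<open>No model is mentioned, so the same bits are read in \<open>W\<close> and in
  \<open>V\<close>.\<close>

definition bit :: "'u \<Rightarrow> nat \<Rightarrow> bool" where
  "bit x n \<longleftrightarrow> pair (num n) (num 1) \<^bold>\<in> x"

definition real_graph :: "(nat \<Rightarrow> bool) \<Rightarrow> 'u set" where
  "real_graph u = range (\<lambda>n. pair (num n) (num (of_bool (u n))))"

end

section \<open>Closure of a transitive model under set operations, and definability with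
  parameters\<close>

locale transitive_model = set_universe +
  fixes M :: "'a set"
  assumes trans_M: "transitive M" and ZFC: "ZFC_model M"
begin

lemma elems_subset: "x \<in> M \<Longrightarrow> elems x \<subseteq> M"
  using trans_M by (auto simp: transitive_def)

lemma memD: "z \<^bold>\<in> x \<Longrightarrow> x \<in> M \<Longrightarrow> z \<in> M"
  using elems_subset by (auto simp: elems_def)

lemma elems_eqI: "x \<in> M \<Longrightarrow> A \<subseteq> M \<Longrightarrow> (\<And>z. z \<in> M \<Longrightarrow> z \<^bold>\<in> x \<longleftrightarrow> z \<in> A) \<Longrightarrow> elems x = A"
  using elems_subset by (auto simp: elems_def)

text \<open>Turns axioms of the model into closure properties of a family of HOL sets, so that later
  constructions can be written as ordinary set comprehensions.\<close>

definition represented :: "'a set \<Rightarrow> bool" where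
  "represented A \<longleftrightarrow> (\<exists>x\<in>M. elems x = A)"

lemma representedD: "represented A \<Longrightarrow> cod A \<in> M \<and> elems (cod A) = A"
  by (auto simp: represented_def)

lemma represented_mem: "represented A \<Longrightarrow> z \<^bold>\<in> cod A \<longleftrightarrow> z \<in> A"
  using representedD by (auto simp: elems_def)

lemma represented_elems: "x \<in> M \<Longrightarrow> represented (elems x)"
  by (auto simp: represented_def)

lemma represented_subset: "represented A \<Longrightarrow> A \<subseteq> M"
  using elems_subset by (auto simp: represented_def)

lemma represented_cod: "represented A \<Longrightarrow> cod A \<in> M"
  by (simp add: representedD)

lemma represented_upair: assumes "a \<in> M" "b \<in> M" shows "represented {a, b}"
proof -
  have "pairing_ax M" using ZFC by (simp add: ZFC_model_def)
  then obtain p where "p \<in> M" "is_upair M a b p" using assms by (auto simp: pairing_ax_def)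
  then have "elems p = {a, b}" using assms by (intro elems_eqI) (auto simp: is_upair_def)
  then show ?thesis using \<open>p \<in> M\<close> by (auto simp: represented_def)
qed

lemma represented_Union: assumes "represented A" shows "represented (\<Union> (elems ` A))"
proof -
  have "union_ax M" using ZFC by (simp add: ZFC_model_def)
  then obtain u where u: "u \<in> M" "\<forall>z\<in>M. z \<^bold>\<in> u \<longleftrightarrow> (\<exists>y\<in>M. y \<^bold>\<in> cod A \<and> z \<^bold>\<in> y)"
    using representedD[OF assms] unfolding union_ax_def by blast
  have "elems u = \<Union> (elems ` A)"
    using u represented_subset[OF assms] elems_subset
    by (intro elems_eqI) (auto simp: represented_mem[OF assms] elems_def)
  then show ?thesis using u by (auto simp: represented_def)
qed

lemma represented_Un:
  assumes "represented A" "represented B" shows "represented (A \<union> B)"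
  using represented_Union[OF represented_upair[OF represented_cod[OF assms(1)] represented_cod[OF assms(2)]]]
    assms by (simp add: representedD)

lemma represented_insert: "a \<in> M \<Longrightarrow> represented A \<Longrightarrow> represented (insert a A)"
  using represented_Un[of "{a}" A] represented_upair[of a a] by simp

lemma represented_Pow: assumes "represented A" shows "represented {y \<in> M. elems y \<subseteq> A}"
proof -
  have "powerset_ax M" using ZFC by (simp add: ZFC_model_def)
  then obtain u where u: "u \<in> M" "\<forall>y\<in>M. y \<^bold>\<in> u \<longleftrightarrow> is_subset M y (cod A)"
    using representedD[OF assms] unfolding powerset_ax_def by blast
  have "elems u = {y \<in> M. elems y \<subseteq> A}"
    using u elems_subset
    by (intro elems_eqI) (auto simp: is_subset_def represented_mem[OF assms] elems_def)
  then show ?thesis using u by (auto simp: represented_def)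
qed

text \<open>Predicates are considered on environments, so that a quantifier over the model turns into an
  index shift \<open>\<lambda>i. a (Suc i)\<close>, as for de Bruijn indices; definability then follows the structure of
  the HOL formula by resolution.\<close>

definition definable :: "((nat \<Rightarrow> 'a) \<Rightarrow> bool) \<Rightarrow> bool" where
  "definable Q \<longleftrightarrow>
     (\<exists>p e. range e \<subseteq> M \<and> (\<forall>a. range a \<subseteq> M \<longrightarrow> sat M (merge a e) p = Q a))"

text \<open>A term is given by its graph: the value sits at index 0 and the arguments move up by
  one.\<close>

definition defterm :: "((nat \<Rightarrow> 'a) \<Rightarrow> 'a) \<Rightarrow> bool" where
  "defterm t \<longleftrightarrow> (\<forall>a. range a \<subseteq> M \<longrightarrow> t a \<in> M) \<and> definable (\<lambda>a. a 0 = t (\<lambda>i. a (Suc i)))"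

abbreviation defnat :: "((nat \<Rightarrow> 'a) \<Rightarrow> nat) \<Rightarrow> bool" where
  "defnat t \<equiv> defterm (\<lambda>a. num (t a))"

lemma definable_cong:
  "definable P \<Longrightarrow> (\<And>a. range a \<subseteq> M \<Longrightarrow> P a = Q a) \<Longrightarrow> definable Q"
  by (auto simp: definable_def)

lemma definable_not: assumes "definable P" shows "definable (\<lambda>a. \<not> P a)"
proof -
  obtain p e where "range e \<subseteq> M" "\<forall>a. range a \<subseteq> M \<longrightarrow> sat M (merge a e) p = P a"
    using assms by (auto simp: definable_def)
  then show ?thesis unfolding definable_def by (intro exI[of _ "Neg p"] exI[of _ e]) auto
qed

lemma definable_conj:
  assumes "definable P" "definable Q" shows "definable (\<lambda>a. P a \<and> Q a)"
proof -
  obtain p e where p: "range e \<subseteq> M" "\<forall>a. range a \<subseteq> M \<longrightarrow> sat M (merge a e) p = P a"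
    using assms by (auto simp: definable_def)
  obtain q e' where q: "range e' \<subseteq> M" "\<forall>a. range a \<subseteq> M \<longrightarrow> sat M (merge a e') q = Q a"
    using assms by (auto simp: definable_def)
  \<comment> \<open>Variables stay; parameter \<open>j\<close> of the first formula becomes
    parameter \<open>2 * j\<close> of the merged list, that of the second
    \<open>2 * j + 1\<close>.\<close>
  define \<rho> where "\<rho> = (\<lambda>i::nat. if even i then i else Suc (2 * (2 * (i div 2))))"
  define \<rho>' where "\<rho>' = (\<lambda>i::nat. if even i then i else Suc (2 * Suc (2 * (i div 2))))"
  have "merge a (merge e e') \<circ> \<rho> = merge a e" for a
    by (rule ext) (auto simp: \<rho>_def merge_def elim!: oddE)
  moreover have "merge a (merge e e') \<circ> \<rho>' = merge a e'" for a
    by (rule ext) (auto simp: \<rho>'_def merge_def elim!: oddE)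
  ultimately show ?thesis unfolding definable_def using p q
    by (intro exI[of _ "Conj (rename_fm \<rho> p) (rename_fm \<rho>' q)"] exI[of _ "merge e e'"])
      (simp add: sat_rename range_merge)
qed

lemma definable_ball_M:
  assumes "definable (\<lambda>a. Q (a 0) (\<lambda>i. a (Suc i)))"
  shows "definable (\<lambda>a. \<forall>x\<in>M. Q x a)"
proof -
  obtain p e where p: "range e \<subseteq> M"
    "\<And>a. range a \<subseteq> M \<Longrightarrow> sat M (merge a e) p = Q (a 0) (\<lambda>i. a (Suc i))"
    using assms by (auto simp: definable_def)
  \<comment> \<open>The binder pushes its value in front of the merged environment. Hence variable
    \<open>b + 1\<close> is found at \<open>2 * b + 1\<close> instead of \<open>2 * b + 2\<close>,
    and parameter \<open>b\<close> at \<open>2 * b + 2\<close> instead of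
    \<open>2 * b + 1\<close>.\<close>
  define \<rho> where "\<rho> = (\<lambda>i::nat. if i = 0 then 0 else if even i then i - 1 else i + 1)"
  have *: "case_nat x (merge a e) \<circ> \<rho> = merge (case_nat x a) e" for a x
  proof
    fix i
    consider "i = 0" | b where "i = Suc (Suc (2 * b))" | b where "i = Suc (2 * b)"
    proof (cases "even i")
      case True
      then obtain b where "i = 2 * b" by (rule evenE)
      then show ?thesis using that(1) that(2)[of "b - 1"] by (cases b) auto
    qed (use that(3) oddE in \<open>metis Suc_eq_plus1\<close>)
    then show "(case_nat x (merge a e) \<circ> \<rho>) i = merge (case_nat x a) e i"
      by cases (simp_all add: \<rho>_def merge_def)
  qed
  have "range (case_nat x a) \<subseteq> M" if "range a \<subseteq> M" "x \<in> M" for a x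
    using that by (auto simp: image_subset_iff split: nat.split)
  then have "sat M (merge a e) (Forall (rename_fm \<rho> p)) = (\<forall>x\<in>M. Q x a)" if "range a \<subseteq> M" for a
    using p(2)[of "case_nat _ a"] that by (simp add: sat_rename *)
  then show ?thesis unfolding definable_def using p(1)
    by (intro exI[of _ "Forall (rename_fm \<rho> p)"] exI[of _ e]) blast
qed

lemma definable_const: "definable (\<lambda>a. c)"
proof -
  obtain z where "z \<in> M" using ZFC by (auto simp: ZFC_model_def infinity_ax_def)
  then show ?thesis unfolding definable_def
    by (intro exI[of _ "if c then Equal 0 0 else Neg (Equal 0 0)"] exI[of _ "\<lambda>_. z"]) auto
qed

lemma definable_disj:
  "definable P \<Longrightarrow> definable Q \<Longrightarrow> definable (\<lambda>a. P a \<or> Q a)"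
  using definable_not[OF definable_conj[OF definable_not definable_not]] by simp

lemma definable_imp:
  "definable P \<Longrightarrow> definable Q \<Longrightarrow> definable (\<lambda>a. P a \<longrightarrow> Q a)"
  unfolding imp_conv_disj by (intro definable_disj definable_not)

lemma definable_iff:
  "definable P \<Longrightarrow> definable Q \<Longrightarrow> definable (\<lambda>a. P a \<longleftrightarrow> Q a)"
  unfolding iff_conv_conj_imp by (intro definable_conj definable_imp)

lemma definable_if:
  "definable R \<Longrightarrow> definable P \<Longrightarrow> definable Q \<Longrightarrow> definable (\<lambda>a. if R a then P a else Q a)"
  unfolding if_bool_eq_conj by (intro definable_conj definable_imp definable_not)

lemma definable_bex_M:
  assumes "definable (\<lambda>a. Q (a 0) (\<lambda>i. a (Suc i)))"
  shows "definable (\<lambda>a. \<exists>x\<in>M. Q x a)"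
  using definable_not[OF definable_ball_M[OF definable_not[OF assms]]] by simp

lemma definable_var:
  "definable (\<lambda>a. a i \<^bold>\<in> a j)" "definable (\<lambda>a. a i = a j)"
proof -
  obtain z where z: "range (\<lambda>_::nat. z) \<subseteq> M"
    using ZFC by (auto simp: ZFC_model_def infinity_ax_def)
  have "sat M (merge a (\<lambda>_. z)) (Member (2 * i) (2 * j)) = (a i \<^bold>\<in> a j)"
    "sat M (merge a (\<lambda>_. z)) (Equal (2 * i) (2 * j)) = (a i = a j)" for a
    by (simp_all only: sat.simps merge_simps)
  with z show "definable (\<lambda>a. a i \<^bold>\<in> a j)" "definable (\<lambda>a. a i = a j)"
    unfolding definable_def by blast+
qed

lemma defterm_var: "defterm (\<lambda>a. a i)"
  by (auto simp: defterm_def definable_var)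

lemma defterm_param: assumes "c \<in> M" shows "defterm (\<lambda>a. c)"
proof -
  have "definable (\<lambda>a. a 0 = c)" unfolding definable_def
    using assms by (intro exI[of _ "Equal (2 * 0) (Suc (2 * 0))"] exI[of _ "\<lambda>_. c"])
      (auto simp: merge_def)
  then show ?thesis using assms by (simp add: defterm_def)
qed

lemma definable_rename:
  assumes "definable Q" shows "definable (\<lambda>a. Q (\<lambda>i. a (\<sigma> i)))"
proof -
  obtain p e where p: "range e \<subseteq> M" "\<And>a. range a \<subseteq> M \<Longrightarrow> sat M (merge a e) p = Q a"
    using assms by (auto simp: definable_def)
  define \<rho> where "\<rho> = (\<lambda>i::nat. if even i then 2 * \<sigma> (i div 2) else i)"
  have *: "merge a e \<circ> \<rho> = merge (\<lambda>i. a (\<sigma> i)) e" for a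
    by (rule ext) (simp add: \<rho>_def merge_def)
  have "sat M (merge a e) (rename_fm \<rho> p) = Q (\<lambda>i. a (\<sigma> i))" if "range a \<subseteq> M" for a
    unfolding sat_rename * using that by (intro p(2)) auto
  then show ?thesis unfolding definable_def using p(1) by blast
qed

lemma definable_subst:
  assumes "definable (\<lambda>a. Q (a 0) (\<lambda>i. a (Suc i)))" "defterm t"
  shows "definable (\<lambda>a. Q (t a) a)"
proof -
  have "definable (\<lambda>a. \<exists>x\<in>M. x = t a \<and> Q x a)"
    using assms by (intro definable_bex_M definable_conj) (auto simp: defterm_def)
  then show ?thesis
    by (rule definable_cong) (use assms in \<open>auto simp: defterm_def\<close>)
qed

lemma defterm_shift: assumes "defterm t" shows "defterm (\<lambda>a. t (\<lambda>i. a (Suc i)))"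
  using definable_rename[of "\<lambda>a. a 0 = t (\<lambda>i. a (Suc i))" "case_nat 0 (\<lambda>i. Suc (Suc i))"] assms
  unfolding defterm_def by (auto simp: image_subset_iff)

lemma definable_atoms:
  assumes "defterm s" "defterm t"
  shows "definable (\<lambda>a. s a \<^bold>\<in> t a)" "definable (\<lambda>a. s a = t a)"
  by (rule definable_subst[OF _ assms(1)], rule definable_subst[OF _ defterm_shift[OF assms(2)]],
      rule definable_var)+

lemma defterm_rename:
  assumes "defterm t" shows "defterm (\<lambda>a. t (\<lambda>i. a (\<sigma> i)))"
  using definable_rename[of "\<lambda>a. a 0 = t (\<lambda>i. a (Suc i))" "case_nat 0 (\<lambda>i. Suc (\<sigma> i))"] assms
  unfolding defterm_def by (auto simp: image_subset_iff)

lemma definable_bex_elems: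
  assumes "defterm t" "definable (\<lambda>a. Q (a 0) (\<lambda>i. a (Suc i)))"
  shows "definable (\<lambda>a. \<exists>x\<in>elems (t a). Q x a)"
proof -
  have "definable (\<lambda>a. \<exists>x\<in>M. x \<^bold>\<in> t a \<and> Q x a)"
    using assms by (intro definable_bex_M definable_conj definable_atoms defterm_var defterm_shift)
  then show ?thesis
    by (rule definable_cong) (use assms elems_subset in \<open>auto simp: defterm_def elems_def\<close>)
qed

lemma definable_ball_elems:
  assumes "defterm t" "definable (\<lambda>a. Q (a 0) (\<lambda>i. a (Suc i)))"
  shows "definable (\<lambda>a. \<forall>x\<in>elems (t a). Q x a)"
  using definable_not[OF definable_bex_elems[OF assms(1) definable_not[OF assms(2)]]] by simp

lemma represented_sep:
  assumes "represented A" "definable (\<lambda>a. Q (a 0))" shows "represented {z \<in> A. Q z}"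
proof -
  have sep: "separation_ax M" using ZFC by (simp add: ZFC_model_def)
  obtain p e where p: "range e \<subseteq> M" "\<And>a. range a \<subseteq> M \<Longrightarrow> sat M (merge a e) p = Q (a 0)"
    using assms by (auto simp: definable_def)
  \<comment> \<open>The separation scheme offers one variable followed by the parameters; all
    variables other than the first are filled with the parameter \<open>e 0\<close>.\<close>
  define \<rho> where "\<rho> = (\<lambda>i::nat. if i = 0 then 0 else if even i then 1 else Suc (i div 2))"
  have "case_nat z e \<circ> \<rho> = merge (case_nat z (\<lambda>_. e 0)) e" for z
    by (rule ext) (auto simp: \<rho>_def merge_def elim!: evenE split: nat.split)
  then have *: "sat M (case_nat z e) (rename_fm \<rho> p) = Q z" if "z \<in> M" for z
    using p(2)[of "case_nat z (\<lambda>_. e 0)"] p(1) that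
    by (auto simp: sat_rename image_subset_iff split: nat.split)
  obtain y where y: "y \<in> M"
    "\<forall>z\<in>M. z \<^bold>\<in> y \<longleftrightarrow> z \<^bold>\<in> cod A \<and> sat M (case_nat z e) (rename_fm \<rho> p)"
    using sep p(1) represented_cod[OF assms(1)] unfolding separation_ax_def by blast
  have "elems y = {z \<in> A. Q z}"
    using y represented_subset[OF assms(1)]
    by (intro elems_eqI) (auto simp: represented_mem[OF assms(1)] *)
  then show ?thesis using y by (auto simp: represented_def)
qed

section \<open>Numerals and the set of natural numbers\<close>

lemma represented_empty: "represented {}"
proof -
  obtain z where "z \<in> M" "is_empty M z"
    using ZFC by (auto simp: ZFC_model_def infinity_ax_def is_inductive_def)
  then show ?thesis unfolding represented_def
    by (intro bexI[of _ z] elems_eqI) (auto simp: is_empty_def)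
qed

lemma represented_finite: "finite A \<Longrightarrow> A \<subseteq> M \<Longrightarrow> represented A"
  by (induction rule: finite_induct) (auto intro: represented_empty represented_insert)

lemma cod_insert_closed: "x \<in> M \<Longrightarrow> cod (insert x (elems x)) \<in> M"
  by (intro represented_cod represented_insert represented_elems)

lemma elems_cod_insert: "x \<in> M \<Longrightarrow> elems (cod (insert x (elems x))) = insert x (elems x)"
  by (simp add: representedD represented_insert represented_elems)

lemma num_closed: "num n \<in> M"
  by (induction n) (auto simp: num.simps intro: represented_cod represented_empty cod_insert_closed)

lemma elems_num_0: "elems (num 0) = {}"
  by (simp add: representedD represented_empty num.simps)

lemma elems_num_Suc: "elems (num (Suc n)) = insert (num n) (elems (num n))"
  by (simp add: elems_cod_insert num_closed num.simps)

lemma elems_num: "elems (num n) = num ` {..<n}"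
  by (induction n) (auto simp: elems_num_0 elems_num_Suc lessThan_Suc)

lemma num_mem_num: "num m \<^bold>\<in> num n \<longleftrightarrow> m < n"
proof
  show "m < n \<Longrightarrow> num m \<^bold>\<in> num n" using elems_num[of n] by (auto simp: elems_def)
  assume "num m \<^bold>\<in> num n"
  then obtain k where k: "k < n" "num m = num k" using elems_num[of n] by (auto simp: elems_def)
  show "m < n"
  proof (rule ccontr)
    assume "\<not> m < n"
    with k have "num k \<^bold>\<in> num m" using elems_num[of m] by (auto simp: elems_def)
    then show False using k mem_irrefl by simp
  qed
qed

lemma num_inject: "num m = num n \<longleftrightarrow> m = n"
  using num_mem_num mem_irrefl by (metis linorder_neqE_nat)

lemma numof_num: "numof (num n) = n"
  by (simp add: numof_def inv_f_f inj_def num_inject)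

lemma is_empty_iff: "x \<in> M \<Longrightarrow> is_empty M x \<longleftrightarrow> x = num 0"
  using memD elems_num_0 by (auto simp: is_empty_def elems_def elems_inject[symmetric])

lemma is_succ_iff: "x \<in> M \<Longrightarrow> y \<in> M \<Longrightarrow> is_succ M x y \<longleftrightarrow> y = cod (insert x (elems x))"
  using elems_subset[of x] elems_subset[of y] elems_inject[of y "cod (insert x (elems x))"]
    elems_cod_insert[of x] by (auto simp: is_succ_def elems_def)

lemma is_succ_num: "x \<in> M \<Longrightarrow> is_succ M (num n) x \<longleftrightarrow> x = num (Suc n)"
  by (simp add: is_succ_iff num_closed num.simps)

lemma is_inductive_iff:
  "i \<in> M \<Longrightarrow> is_inductive M i \<longleftrightarrow>
     num 0 \<in> elems i \<and> (\<forall>x\<in>elems i. cod (insert x (elems x)) \<in> elems i)"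
  unfolding is_inductive_def
  using elems_subset num_closed[of 0] cod_insert_closed
  by (auto simp: is_empty_iff is_succ_iff elems_def; blast)

lemma is_subset_iff: "x \<in> M \<Longrightarrow> is_subset M x y \<longleftrightarrow> elems x \<subseteq> elems y"
  using elems_subset by (auto simp: is_subset_def elems_def)

lemma num_in_inductive: "i \<in> M \<Longrightarrow> is_inductive M i \<Longrightarrow> num n \<in> elems i"
  by (induction n) (auto simp: is_inductive_iff num.simps(2))

text \<open>A least nonstandard element of \<open>w\<close> could be removed, contradicting minimality: so
  well-foundedness of the background makes every \<open>\<omega>\<close> standard.\<close>

lemma is_omegaD:
  assumes "w \<in> M" "is_omega M w" shows "elems w = range num"
proof
  have ind: "is_inductive M w" using assms by (simp add: is_omega_def)
  then show "range num \<subseteq> elems w" using num_in_inductive assms by auto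
  show "elems w \<subseteq> range num"
  proof (rule ccontr)
    assume "\<not> elems w \<subseteq> range num"
    then obtain z0 where "z0 \<in> elems w - range num" by blast
    then obtain z where z: "z \<in> elems w - range num"
      "\<And>y. y \<^bold>\<in> z \<Longrightarrow> y \<notin> elems w - range num"
      using wfE_min[OF wellfounded[unfolded wfp_def]] by (metis (no_types, lifting) case_prodI mem_Collect_eq)
    let ?w = "{y \<in> elems w. y \<noteq> z}"
    have zM: "z \<in> M" using z elems_subset[OF assms(1)] by auto
    have rep: "represented ?w"
      by (intro represented_sep represented_elems assms definable_not definable_atoms
          defterm_var defterm_param zM)
    have "is_inductive M (cod ?w)"
      unfolding is_inductive_iff[OF represented_cod[OF rep]] conjunct2[OF representedD[OF rep]]
    proof (intro conjI ballI)
      show "num 0 \<in> ?w" using z num_in_inductive[OF assms(1) ind, of 0] by (auto)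
      fix x assume x: "x \<in> ?w"
      then have xM: "x \<in> M" using elems_subset assms by auto
      have "cod (insert x (elems x)) \<noteq> z"
      proof
        assume eq: "cod (insert x (elems x)) = z"
        then have "x \<^bold>\<in> z" using elems_cod_insert[OF xM] by (auto simp: elems_def)
        then have "x \<in> range num" using z(2) x by auto
        then have "z \<in> range num" using eq num.simps(2) by (metis rangeE rangeI)
        then show False using z by auto
      qed
      then show "cod (insert x (elems x)) \<in> ?w"
        using x ind is_inductive_iff[OF assms(1)] by auto
    qed
    then have "is_subset M w (cod ?w)"
      using assms(2) represented_cod[OF rep] unfolding is_omega_def by blast
    then have "elems w \<subseteq> ?w"
      unfolding is_subset_iff[OF assms(1)] conjunct2[OF representedD[OF rep]] .
    then show False using z by auto
  qed
qed

lemmas definable_basic = definable_not definable_conj definable_disj definable_imp definable_iff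
  definable_if definable_ball_M definable_bex_M definable_ball_elems definable_bex_elems
  definable_const definable_atoms defterm_var defterm_param

text \<open>Infinity yields only some inductive set. Separation cuts out of it the intersection of
  all inductive sets of the model, and \<open>is_omegaD\<close> shows that this is standard.\<close>

lemma represented_omega: "represented (range num)"
proof -
  obtain i where i: "i \<in> M" "is_inductive M i"
    using ZFC by (auto simp: ZFC_model_def infinity_ax_def)
  let ?w = "{z \<in> elems i. \<forall>j\<in>M. is_inductive M j \<longrightarrow> z \<^bold>\<in> j}"
  have rep: "represented ?w" unfolding is_inductive_def is_empty_def is_succ_def
    by (intro represented_sep represented_elems i definable_basic)
  have el: "elems (cod ?w) = ?w" using representedD[OF rep] by blast
  have 1: "is_inductive M (cod ?w)"
    unfolding is_inductive_iff[OF represented_cod[OF rep]] el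
  proof (intro conjI ballI)
    show "num 0 \<in> ?w" using i num_in_inductive[of _ 0] by (auto simp: elems_def)
    fix x assume x: "x \<in> ?w"
    have "cod (insert x (elems x)) \<in> elems j" if "j \<in> M" "is_inductive M j" for j
      using that x is_inductive_iff[of j] by (auto simp: elems_def)
    with i show "cod (insert x (elems x)) \<in> ?w" by (auto simp: elems_def)
  qed
  have "is_subset M (cod ?w) j" if "j \<in> M" "is_inductive M j" for j
    unfolding is_subset_iff[OF represented_cod[OF rep]] el using that by (auto simp: elems_def)
  with 1 have "is_omega M (cod ?w)" unfolding is_omega_def by blast
  then have "elems (cod ?w) = range num" by (rule is_omegaD[OF represented_cod[OF rep]])
  with rep el show ?thesis by simp
qed

lemma is_omega_iff: "w \<in> M \<Longrightarrow> is_omega M w \<longleftrightarrow> elems w = range num"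
proof
  assume w: "w \<in> M" "elems w = range num"
  then show "is_omega M w"
    using num_in_inductive
    by (auto simp: is_omega_def is_inductive_iff is_subset_iff num.simps(2)[symmetric])
qed (rule is_omegaD)

lemma is_two_iff: assumes "t \<in> M" shows "is_two M t \<longleftrightarrow> t = num 2"
proof
  assume "is_two M t"
  then obtain z u where "z \<in> M" "u \<in> M" "is_empty M z" "is_succ M z u" "is_succ M u t"
    by (auto simp: is_two_def)
  then show "t = num 2" using assms by (simp add: is_empty_iff is_succ_num numeral_2_eq_2)
next
  assume t: "t = num 2"
  show "is_two M t" unfolding is_two_def
    by (intro bexI[of _ "num 0"] bexI[of _ "num (Suc 0)"] conjI)
      (simp_all only: t is_empty_iff is_succ_num num_closed numeral_2_eq_2)
qed

section \<open>Kuratowski pairs and graphs\<close>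

lemma upair_closed: "a \<in> M \<Longrightarrow> b \<in> M \<Longrightarrow> cod {a, b} \<in> M"
  by (intro represented_cod represented_upair)

lemma elems_upair: "a \<in> M \<Longrightarrow> b \<in> M \<Longrightarrow> elems (cod {a, b}) = {a, b}"
  by (simp add: representedD represented_upair)

lemma is_upair_iff: "a \<in> M \<Longrightarrow> b \<in> M \<Longrightarrow> p \<in> M \<Longrightarrow> is_upair M a b p \<longleftrightarrow> p = cod {a, b}"
  using elems_subset[of p] elems_inject[of p "cod {a, b}"] elems_upair[of a b]
  by (auto simp: is_upair_def elems_def)

lemma pair_closed: "a \<in> M \<Longrightarrow> b \<in> M \<Longrightarrow> pair a b \<in> M"
  using upair_closed[of a a] by (simp add: pair_def upair_closed)

lemma is_pair_iff: "a \<in> M \<Longrightarrow> b \<in> M \<Longrightarrow> p \<in> M \<Longrightarrow> is_pair M a b p \<longleftrightarrow> p = pair a b"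
  using upair_closed[of a a] upair_closed[of a b] by (auto simp: is_pair_def is_upair_iff pair_def)

lemma upair_inject:
  "a \<in> M \<Longrightarrow> b \<in> M \<Longrightarrow> c \<in> M \<Longrightarrow> d \<in> M \<Longrightarrow> cod {a, b} = cod {c, d} \<longleftrightarrow> {a, b} = {c, d}"
  by (metis elems_upair)

lemma pair_inject:
  assumes "a \<in> M" "b \<in> M" "c \<in> M" "d \<in> M"
  shows "pair a b = pair c d \<longleftrightarrow> a = c \<and> b = d"
proof
  assume "pair a b = pair c d"
  then have "cod {cod {a, a}, cod {a, b}} = cod {cod {c, c}, cod {c, d}}" by (simp add: pair_def)
  then have "{cod {a, a}, cod {a, b}} = {cod {c, c}, cod {c, d}}"
    by (rule iffD1[OF upair_inject, rotated -1]) (intro upair_closed assms)+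
  then show "a = c \<and> b = d"
    using upair_inject[of a a c c] upair_inject[of a a c d] upair_inject[of a b c c]
      upair_inject[of a b c d] assms
    by (auto simp: doubleton_eq_iff)
qed simp

lemma maps_to_iff: "a \<in> M \<Longrightarrow> b \<in> M \<Longrightarrow> maps_to M f a b \<longleftrightarrow> pair a b \<^bold>\<in> f"
  by (auto simp: maps_to_def is_pair_iff pair_closed)

text \<open>Kuratowski pairs over \<open>A\<close> and \<open>B\<close> lie in the double power set
  of \<open>A \<union> B\<close>, so separation from it is enough.\<close>

lemma represented_graph:
  assumes A: "represented A" and B: "represented B"
    and Q: "definable (\<lambda>a. Q (a 0) (a (Suc 0)))"
  shows "represented {pair x y | x y. x \<in> A \<and> y \<in> B \<and> Q x y}"
proof -
  let ?P = "{p \<in> {u \<in> M. elems u \<subseteq> {u \<in> M. elems u \<subseteq> A \<union> B}}.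
    \<exists>x\<in>elems (cod A). \<exists>y\<in>elems (cod B). is_pair M x y p \<and> Q x y}"
  have "represented ?P"
    unfolding is_pair_def is_upair_def
    by (intro represented_sep represented_Pow represented_Un A B definable_basic represented_cod
        \<comment> \<open>Under the two quantifiers the inner variable \<open>y\<close> has index 0
          and \<open>x\<close> has index 1, hence the swap.\<close>
        definable_rename[OF Q, of "case_nat (Suc 0) (\<lambda>_. 0)", simplified])
  also have "?P = {pair x y | x y. x \<in> A \<and> y \<in> B \<and> Q x y}" (is "_ = ?R")
  proof -
    have "pair x y \<in> {u \<in> M. elems u \<subseteq> {u \<in> M. elems u \<subseteq> A \<union> B}}" if "x \<in> A" "y \<in> B" for x y
    proof -
      have "x \<in> M" "y \<in> M" using that represented_subset A B by auto
      then show ?thesis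
        using that pair_closed[of x y] upair_closed[of x x] upair_closed[of x y]
          elems_upair[of x x] elems_upair[of x y] elems_upair[of "cod {x}" "cod {x, y}"]
        unfolding pair_def by auto
    qed
    moreover have "is_pair M x y p \<longleftrightarrow> p = pair x y" if "x \<in> A" "y \<in> B" "p \<in> M" for x y p
      using is_pair_iff that represented_subset[OF A] represented_subset[OF B] by blast
    ultimately show ?thesis using representedD[OF A] representedD[OF B] by fastforce
  qed
  finally show ?thesis .
qed

end

section \<open>Predicates, relations and functions on the naturals that a model possesses\<close>

context set_universe
begin

definition has_pred :: "'u set \<Rightarrow> (nat \<Rightarrow> bool) \<Rightarrow> bool" where
  "has_pred M u \<longleftrightarrow> (\<exists>c\<in>M. \<forall>n. u n \<longleftrightarrow> num n \<^bold>\<in> c)"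

definition has_rel :: "'u set \<Rightarrow> (nat \<Rightarrow> nat \<Rightarrow> bool) \<Rightarrow> bool" where
  "has_rel M R \<longleftrightarrow> (\<exists>c\<in>M. \<forall>m n. R m n \<longleftrightarrow> pair (num m) (num n) \<^bold>\<in> c)"

definition has_fun :: "'u set \<Rightarrow> (nat \<Rightarrow> nat) \<Rightarrow> bool" where
  "has_fun M f \<longleftrightarrow> has_rel M (\<lambda>m n. f m = n)"

lemma has_mono:
  assumes "M \<subseteq> N"
  shows "has_pred M u \<Longrightarrow> has_pred N u" "has_rel M R \<Longrightarrow> has_rel N R" "has_fun M f \<Longrightarrow> has_fun N f"
  using assms by (auto simp: has_pred_def has_rel_def has_fun_def)

end

context transitive_model
begin

lemma definable_pair_eq:
  assumes "defterm s" "defterm t" "defterm r"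
  shows "definable (\<lambda>a. r a = pair (s a) (t a))"
proof -
  have "definable (\<lambda>a. is_pair M (s a) (t a) (r a))"
    unfolding is_pair_def is_upair_def
    by (intro definable_basic assms[THEN defterm_rename])
  then show ?thesis
    by (rule definable_cong) (use assms in \<open>auto simp: defterm_def is_pair_iff\<close>)
qed

lemma defterm_pair: "defterm s \<Longrightarrow> defterm t \<Longrightarrow> defterm (\<lambda>a. pair (s a) (t a))"
  using definable_pair_eq[of "\<lambda>a. s (\<lambda>i. a (Suc i))" "\<lambda>a. t (\<lambda>i. a (Suc i))" "\<lambda>a. a 0"]
  by (auto simp: defterm_def[of "\<lambda>a. pair (s a) (t a)"] defterm_shift defterm_var)
    (auto simp: defterm_def pair_closed)

section \<open>Natural numbers and recursion in a transitive model\<close>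

lemma num_numof: "num (numof x) = (if x \<in> range num then x else num 0)"
  by (simp add: numof_def f_inv_into_f)

lemma defnat_numof: assumes "defterm t" shows "defnat (\<lambda>a. numof (t a))"
proof -
  have "definable (\<lambda>a. if t (\<lambda>i. a (Suc i)) \<^bold>\<in> cod (range num) then a 0 = t (\<lambda>i. a (Suc i)) else a 0 = num 0)"
    by (intro definable_basic defterm_shift[OF assms] represented_cod represented_omega num_closed)
  then have "definable (\<lambda>a. a 0 = num (numof (t (\<lambda>i. a (Suc i)))))"
    unfolding num_numof represented_mem[OF represented_omega] 
    by (rule definable_cong) (rule if_distrib[where f = "(=) (a 0)" for a, symmetric])
  then show ?thesis by (simp add: defterm_def num_closed)
qed

lemma definable_ex_nat:
  assumes "definable (\<lambda>a. Q (numof (a 0)) (\<lambda>i. a (Suc i)))"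
  shows "definable (\<lambda>a. \<exists>n. Q n a)"
  by (rule definable_cong[OF definable_bex_M[of "\<lambda>x. Q (numof x)", OF assms]])
    (use num_closed numof_num in metis)

lemma definable_all_nat:
  assumes "definable (\<lambda>a. Q (numof (a 0)) (\<lambda>i. a (Suc i)))"
  shows "definable (\<lambda>a. \<forall>n. Q n a)"
  using definable_not[OF definable_ex_nat[OF definable_not[OF assms]]] by simp

lemma defnat_const: "defnat (\<lambda>a. c)"
  by (intro defterm_param num_closed)

lemma definable_nat_atoms:
  assumes "defnat s" "defnat t"
  shows "definable (\<lambda>a. s a < t a)" "definable (\<lambda>a. s a = t a)" "definable (\<lambda>a. s a \<le> t a)"
proof -
  show 1: "definable (\<lambda>a. s a < t a)" and 2: "definable (\<lambda>a. s a = t a)"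
    using definable_atoms[OF assms] by (simp_all add: num_mem_num num_inject)
  show "definable (\<lambda>a. s a \<le> t a)"
    unfolding le_less by (intro definable_disj 1 2)
qed

lemma definable_num_eq: "defterm t \<Longrightarrow> defnat n \<Longrightarrow> definable (\<lambda>a. t a = num (n a))"
  by (rule definable_atoms)

lemma defnatI: "definable (\<lambda>a. a 0 = num (n (\<lambda>i. a (Suc i)))) \<Longrightarrow> defnat n"
  by (simp add: defterm_def num_closed)

lemma defnat_Suc: assumes "defnat n" shows "defnat (\<lambda>a. Suc (n a))"
proof (rule defnatI)
  have "definable (\<lambda>a. \<forall>z\<in>M. z \<^bold>\<in> a 0 \<longleftrightarrow> z \<^bold>\<in> num (n (\<lambda>i. a (Suc i))) \<or> z = num (n (\<lambda>i. a (Suc i))))"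
    by (intro definable_basic defterm_rename[OF assms])
  then show "definable (\<lambda>a. a 0 = num (Suc (n (\<lambda>i. a (Suc i)))))"
  proof (rule definable_cong)
    fix a :: "nat \<Rightarrow> 'a"
    assume "range a \<subseteq> M"
    then have "a 0 \<in> M" by auto
    from is_succ_num[OF this] show "(\<forall>z\<in>M. z \<^bold>\<in> a 0 \<longleftrightarrow> z \<^bold>\<in> num (n (\<lambda>i. a (Suc i))) \<or> z = num (n (\<lambda>i. a (Suc i))))
      \<longleftrightarrow> a 0 = num (Suc (n (\<lambda>i. a (Suc i))))"
      unfolding is_succ_def .
  qed
qed

lemma defterm_if:
  assumes "definable R" "defterm s" "defterm t" shows "defterm (\<lambda>a. if R a then s a else t a)"
proof -
  have "definable (\<lambda>a. if R (\<lambda>i. a (Suc i)) then a 0 = s (\<lambda>i. a (Suc i)) else a 0 = t (\<lambda>i. a (Suc i)))"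
    using assms(2,3) by (intro definable_if definable_rename[OF assms(1)]) (simp_all add: defterm_def)
  then have "definable (\<lambda>a. a 0 = (if R (\<lambda>i. a (Suc i)) then s (\<lambda>i. a (Suc i)) else t (\<lambda>i. a (Suc i))))"
    by (rule definable_cong) auto
  then show ?thesis using assms by (auto simp: defterm_def)
qed

lemma defnat_if:
  "definable R \<Longrightarrow> defnat s \<Longrightarrow> defnat t \<Longrightarrow> defnat (\<lambda>a. if R a then s a else t a)"
  using defterm_if[of R "\<lambda>a. num (s a)" "\<lambda>a. num (t a)"] by (simp add: if_distrib cong: if_cong)

lemma defnat_Least:
  assumes "definable (\<lambda>a. Q (numof (a 0)) (\<lambda>i. a (Suc i)))"
  shows "defnat (\<lambda>a. LEAST k. Q k a)"
proof (rule defnatI)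
  \<comment> \<open>The value that \<open>LEAST\<close> takes when there is no witness: unspecified,
    but one fixed number, so it can be treated as a constant.\<close>
  let ?c = "LEAST k::nat. False"
  have Q: "definable (\<lambda>a. Q (numof (a 0)) (\<lambda>i. a (Suc (Suc i))))"
    "definable (\<lambda>a. Q (numof (a 0)) (\<lambda>i. a (Suc (Suc (Suc i)))))"
    using definable_rename[OF assms, of "case_nat 0 (\<lambda>i. Suc (Suc i))"]
      definable_rename[OF assms, of "case_nat 0 (\<lambda>i. Suc (Suc (Suc i)))"] by simp_all
  have "definable (\<lambda>a. if \<exists>k. Q k (\<lambda>i. a (Suc i))
    then \<exists>k. Q k (\<lambda>i. a (Suc i)) \<and> (\<forall>j. j < k \<longrightarrow> \<not> Q j (\<lambda>i. a (Suc i))) \<and> a 0 = num k else a 0 = num ?c)"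
    by (intro definable_if definable_ex_nat definable_conj definable_all_nat definable_imp
        definable_not Q definable_nat_atoms definable_num_eq defterm_var defnat_numof defnat_const)
  then show "definable (\<lambda>a. a 0 = num (LEAST k. Q k (\<lambda>i. a (Suc i))))"
  proof (rule definable_cong)
    fix a
    let ?Q = "\<lambda>k. Q k (\<lambda>i. a (Suc i))"
    have "?Q k \<and> (\<forall>j<k. \<not> ?Q j) \<longleftrightarrow> k = (LEAST k. ?Q k)" if "\<exists>k. ?Q k" for k
      using that by (metis LeastI_ex not_less_Least Least_equality not_less)
    moreover have "(LEAST k. ?Q k) = ?c" if "\<not> (\<exists>k. ?Q k)" using that by simp
    ultimately show "(if \<exists>k. ?Q k then \<exists>k. ?Q k \<and> (\<forall>j<k. \<not> ?Q j) \<and> a 0 = num k else a 0 = num ?c)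
      \<longleftrightarrow> a 0 = num (LEAST k. ?Q k)"
      by (simp del: ex_simps all_simps) metis
  qed
qed

lemma has_predD:
  assumes "has_pred M u" "defnat t" shows "definable (\<lambda>a. u (t a))"
proof -
  obtain c where c: "c \<in> M" "\<And>n. u n \<longleftrightarrow> num n \<^bold>\<in> c" using assms by (auto simp: has_pred_def)
  show ?thesis unfolding c(2) by (intro definable_atoms defterm_param c assms)
qed

lemma has_relD:
  assumes "has_rel M R" "defnat s" "defnat t" shows "definable (\<lambda>a. R (s a) (t a))"
proof -
  obtain c where c: "c \<in> M" "\<And>m n. R m n \<longleftrightarrow> pair (num m) (num n) \<^bold>\<in> c"
    using assms by (auto simp: has_rel_def)
  show ?thesis unfolding c(2) by (intro definable_atoms defterm_pair defterm_param c assms)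
qed

lemma has_funD:
  assumes "has_fun M f" "defnat t" shows "defnat (\<lambda>a. f (t a))"
proof (rule defnatI)
  have "definable (\<lambda>a. \<exists>n. f (t (\<lambda>i. a (Suc i))) = n \<and> a 0 = num n)"
    by (intro definable_ex_nat definable_conj has_relD[OF assms(1)[unfolded has_fun_def]]
        definable_num_eq defnat_numof defterm_var defterm_rename[OF assms(2)])
  then show "definable (\<lambda>a. a 0 = num (f (t (\<lambda>i. a (Suc i)))))" by simp
qed

text \<open>Together with \<open>has_predD\<close> this is the interface to the model: an HOL
  predicate belongs to \<open>M\<close> once its definition passes the definability rules.\<close>

lemma has_predI: assumes "definable (\<lambda>a. u (numof (a 0)))" shows "has_pred M u"
proof -
  have rep: "represented {z \<in> range num. u (numof z)}"
    by (intro represented_sep represented_omega assms)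
  then show ?thesis unfolding has_pred_def using represented_mem[OF rep]
    by (intro bexI[of _ "cod {z \<in> range num. u (numof z)}"]) (auto simp: numof_num represented_cod)
qed

lemma has_relI: assumes "definable (\<lambda>a. R (numof (a 0)) (numof (a (Suc 0))))" shows "has_rel M R"
proof -
  let ?R = "{pair x y |x y. x \<in> range num \<and> y \<in> range num \<and> R (numof x) (numof y)}"
  have rep: "represented ?R"
    by (intro represented_graph represented_omega assms)
  have "R m n \<longleftrightarrow> pair (num m) (num n) \<^bold>\<in> cod ?R" for m n
    unfolding represented_mem[OF rep]
  proof
    assume "R m n"
    then have "pair (num m) (num n) = pair (num m) (num n) \<and> num m \<in> range num \<and>
        num n \<in> range num \<and> R (numof (num m)) (numof (num n))"
      by (simp add: numof_num)
    then show "pair (num m) (num n) \<in> ?R" by blast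
  qed (auto simp: pair_inject num_closed num_inject numof_num)
  then show ?thesis unfolding has_rel_def using represented_cod[OF rep] by blast
qed

lemma has_funI: assumes "defnat (\<lambda>a. f (numof (a 0)))" shows "has_fun M f"
  unfolding has_fun_def
  by (intro has_relI definable_nat_atoms defterm_rename[OF assms, of "\<lambda>_. 0"] defnat_numof defterm_var)

lemma definable_bit:
  assumes "defterm t" "defnat n" shows "definable (\<lambda>a. bit (t a) (n a))"
  unfolding bit_def by (intro definable_atoms defterm_pair defterm_param num_closed assms)

lemmas defnat_basic = definable_ex_nat definable_all_nat definable_nat_atoms
  defnat_numof defnat_const defnat_Suc defnat_if defnat_Least definable_bit

text \<open>The value at \<open>n\<close> lies in every set containing the initial pair and closed below \<open>n\<close> under
  the recursion step; the finite graph up to \<open>n\<close> is one such set.\<close>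

lemma defnat_rec:
  assumes z: "defnat z" and F: "defnat (\<lambda>a. F (numof (a 0)) (numof (a (Suc 0))) (\<lambda>i. a (Suc (Suc i))))"
    and n: "defnat n"
  shows "defnat (\<lambda>a. rec_nat (z a) (\<lambda>k s. F k s a) (n a))"
proof (rule defnatI)
  \<comment> \<open>The five shifts account for the result slot and the bound \<open>b\<close>,
    \<open>S\<close>, \<open>j\<close>, \<open>c\<close>; among these \<open>c\<close> has index 0
    and \<open>j\<close> index 1.\<close>
  have F': "defnat (\<lambda>a. F (numof (a (Suc 0))) (numof (a 0)) (\<lambda>i. a (Suc (Suc (Suc (Suc (Suc i)))))))"
    using defterm_rename[OF F, of "case_nat (Suc 0) (case_nat 0 (\<lambda>i. Suc (Suc (Suc (Suc (Suc i))))))"]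
    by simp
  define G where "G = (\<lambda>a b. \<forall>S\<in>M. pair (num 0) (num (z a)) \<^bold>\<in> S \<and>
    (\<forall>j c. j < n a \<longrightarrow> pair (num j) (num c) \<^bold>\<in> S \<longrightarrow> pair (num (Suc j)) (num (F j c a)) \<^bold>\<in> S)
    \<longrightarrow> pair (num (n a)) (num b) \<^bold>\<in> S)"
  have "definable (\<lambda>a. \<exists>b. G (\<lambda>i. a (Suc i)) b \<and> a 0 = num b)"
    unfolding G_def
    by (intro definable_basic defnat_basic defterm_pair definable_num_eq F' defterm_rename[OF z]
        defterm_rename[OF n])
  moreover have "G a b \<longleftrightarrow> b = rec_nat (z a) (\<lambda>k s. F k s a) (n a)" for a b
  proof
    let ?r = "rec_nat (z a) (\<lambda>k s. F k s a)"
    let ?S = "(\<lambda>j. pair (num j) (num (?r j))) ` {..n a}"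
    have rep: "represented ?S"
      by (intro represented_finite) (auto intro: pair_closed num_closed)
    assume "G a b"
    moreover have "pair (num 0) (num (z a)) \<^bold>\<in> cod ?S \<and>
      (\<forall>j c. j < n a \<longrightarrow> pair (num j) (num c) \<^bold>\<in> cod ?S \<longrightarrow> pair (num (Suc j)) (num (F j c a)) \<^bold>\<in> cod ?S)"
      unfolding represented_mem[OF rep] by (auto simp: pair_inject num_closed num_inject image_iff)
    ultimately have "pair (num (n a)) (num b) \<^bold>\<in> cod ?S"
      unfolding G_def using represented_cod[OF rep] by blast
    then show "b = ?r (n a)"
      by (auto simp: represented_mem[OF rep] pair_inject num_closed num_inject)
  next
    assume b: "b = rec_nat (z a) (\<lambda>k s. F k s a) (n a)"
    show "G a b" unfolding G_def b
    proof (intro ballI impI)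
      fix S
      assume S: "pair (num 0) (num (z a)) \<^bold>\<in> S \<and>
        (\<forall>j c. j < n a \<longrightarrow> pair (num j) (num c) \<^bold>\<in> S \<longrightarrow> pair (num (Suc j)) (num (F j c a)) \<^bold>\<in> S)"
      have "k \<le> n a \<Longrightarrow> pair (num k) (num (rec_nat (z a) (\<lambda>k s. F k s a) k)) \<^bold>\<in> S" for k
        by (induction k) (use S in auto)
      then show "pair (num (n a)) (num (rec_nat (z a) (\<lambda>k s. F k s a) (n a))) \<^bold>\<in> S" by simp
    qed
  qed
  ultimately show "definable (\<lambda>a. a 0 = num (rec_nat (z (\<lambda>i. a (Suc i)))
      (\<lambda>k s. F k s (\<lambda>i. a (Suc i))) (n (\<lambda>i. a (Suc i)))))"
    by simp
qed

lemma defnat_add: assumes "defnat s" "defnat t" shows "defnat (\<lambda>a. s a + t a)"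
proof -
  have "m + n = rec_nat m (\<lambda>_. Suc) n" for m n :: nat by (induction n) auto
  then show ?thesis
    by (simp only:) (intro defnat_rec assms defnat_basic defterm_var)
qed

text \<open>Triangular numbers give Cantor pairing, which reduces the simultaneous recursion for two
  sequences in \<open>dominated\<close> to a recursion with one value.\<close>

lemma defnat_triangle: assumes "defnat n" shows "defnat (\<lambda>a. triangle (n a))"
proof -
  have "triangle n = rec_nat 0 (\<lambda>k s. s + Suc k) n" for n by (induction n) auto
  then show ?thesis
    by (simp only:) (intro defnat_rec assms defnat_basic defnat_add defterm_var)
qed

lemma defnat_prod_encode: "defnat s \<Longrightarrow> defnat t \<Longrightarrow> defnat (\<lambda>a. prod_encode (s a, t a))"
  unfolding prod_encode_def prod.case by (intro defnat_add defnat_triangle)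

lemma defnat_prod_decode:
  assumes "defnat t"
  shows "defnat (\<lambda>a. fst (prod_decode (t a)))" "defnat (\<lambda>a. snd (prod_decode (t a)))"
proof -
  \<comment> \<open>The component is unique, so \<open>LEAST\<close> merely names it in a form that
    the definability rules accept.\<close>
  have "fst (prod_decode k) = (LEAST m. \<exists>n. prod_encode (m, n) = k)"
    "snd (prod_decode k) = (LEAST n. \<exists>m. prod_encode (m, n) = k)" for k
    by (rule Least_equality[symmetric]; metis prod.collapse prod_decode_inverse prod_encode_inverse
        fst_conv snd_conv order_refl)+
  then show "defnat (\<lambda>a. fst (prod_decode (t a)))" "defnat (\<lambda>a. snd (prod_decode (t a)))"
    by (simp_all only:)
      (intro defnat_basic defnat_prod_encode defterm_var defterm_rename[OF assms])+
qed

lemmas definable_intros = definable_basic defnat_basic defnat_add defnat_prod_encode defnat_prod_decode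

end

section \<open>Following a dense sequence inside a perfect set\<close>

definition agr :: "nat \<Rightarrow> (nat \<Rightarrow> bool) \<Rightarrow> (nat \<Rightarrow> bool) \<Rightarrow> bool" where
  "agr n u v \<longleftrightarrow> (\<forall>k<n. u k = v k)"

definition dif :: "nat \<Rightarrow> (nat \<Rightarrow> bool) \<Rightarrow> (nat \<Rightarrow> bool) \<Rightarrow> bool" where
  "dif n u v \<longleftrightarrow> agr n u v \<and> u n \<noteq> v n"

lemma agr_refl [simp]: "agr n u u"
  by (simp add: agr_def)

lemma agr_sym: "agr n u v \<longleftrightarrow> agr n v u"
  by (auto simp: agr_def)

lemma agr_trans: "agr n u v \<Longrightarrow> agr n v w \<Longrightarrow> agr n u w"
  by (auto simp: agr_def)

lemma agr_mono: "agr n u v \<Longrightarrow> m \<le> n \<Longrightarrow> agr m u v"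
  unfolding agr_def by (meson order_less_le_trans)

lemma agr_Suc: "agr (Suc n) u v \<longleftrightarrow> agr n u v \<and> u n = v n"
  by (auto simp: agr_def less_Suc_eq)

lemma ex_dif: assumes "u \<noteq> v" shows "\<exists>n. dif n u v"
proof -
  have "\<exists>n. u n \<noteq> v n" using assms by blast
  then have "\<exists>n. u n \<noteq> v n \<and> (\<forall>k<n. \<not> u k \<noteq> v k)" by (rule exists_least_iff[THEN iffD1])
  then show ?thesis unfolding dif_def agr_def by blast
qed

lemma dif_agr_iff: assumes "dif m u v" shows "agr n u v \<longleftrightarrow> n \<le> m"
proof
  assume "agr n u v"
  then have "\<not> m < n" using assms unfolding dif_def agr_def by blast
  then show "n \<le> m" by simp
qed (use assms agr_mono in \<open>unfold dif_def, blast\<close>)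

lemma ex_not_agr_finite:
  assumes "finite I" "\<And>i. i \<in> I \<Longrightarrow> u i \<noteq> v i"
  shows "\<exists>n. \<forall>i\<in>I. \<not> agr n (u i) (v i)"
  using assms
proof (induction rule: finite_induct)
  case (insert i I)
  then obtain n where n: "\<forall>i\<in>I. \<not> agr n (u i) (v i)" by blast
  obtain m where m: "dif m (u i) (v i)" using ex_dif[of "u i" "v i"] insert.prems by blast
  have "\<not> agr (max n (Suc m)) (u j) (v j)" if "j \<in> insert i I" for j
  proof (cases "j = i")
    case False
    with that n have "\<not> agr n (u j) (v j)" by blast
    then show ?thesis using agr_mono max.cobounded1 by blast
  qed (simp add: dif_agr_iff[OF m])
  then show ?case by blast
qed simp

text \<open>Pure combinatorics, free of models. The sequence may have terms outside
  \<open>Ps\<close>, because a covering set may contain more than the set it covers.\<close>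

locale dense_enumeration =
  fixes Ps :: "(nat \<Rightarrow> bool) set" and yy :: "nat \<Rightarrow> nat \<Rightarrow> bool"
  assumes perfect: "u \<in> Ps \<Longrightarrow> \<exists>v\<in>Ps. v \<noteq> u \<and> agr n u v"
    and dense: "u \<in> Ps \<Longrightarrow> \<exists>i. yy i \<in> Ps \<and> agr n u (yy i)"
    and nonempty: "Ps \<noteq> {}"
begin

text \<open>The sequence may repeat values. Only first occurrences count, since these can be
  separated from all earlier terms at a finite level.\<close>

definition new :: "nat \<Rightarrow> bool" where
  "new i \<longleftrightarrow> (\<forall>j<i. yy j \<noteq> yy i)"

definition good :: "nat \<Rightarrow> bool" where
  "good i \<longleftrightarrow> yy i \<in> Ps \<and> new i"

text \<open>Agreement with \<open>yy i\<close> up to this level excludes all earlier terms. The free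
  lower bound \<open>G\<close> lets \<open>pred_in_W\<close> exclude terms outside \<open>Ps\<close>
  as well.\<close>

definition sep :: "(nat \<Rightarrow> nat) \<Rightarrow> nat \<Rightarrow> nat" where
  "sep G i = (LEAST n. G i \<le> n \<and> (\<forall>j<i. \<not> agr n (yy j) (yy i)))"

text \<open>The lowest node at level \<open>B\<close> or above where the tree of \<open>Ps\<close>
  branches off \<open>yy i\<close>; \<open>B\<close> acts as a waiting time.\<close>

definition branch :: "nat \<Rightarrow> nat \<Rightarrow> nat" where
  "branch i B = (LEAST m. B \<le> m \<and> (\<exists>v\<in>Ps. dif m (yy i) v))"

text \<open>Taking the least index makes it a first occurrence, and in \<open>pred_in_W\<close> it
  excludes smaller indices in \<open>Ps\<close> that leave \<open>yy i\<close> at the same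
  level.\<close>

definition nxt :: "nat \<Rightarrow> nat \<Rightarrow> nat" where
  "nxt i B = (LEAST j. yy j \<in> Ps \<and> dif (branch i B) (yy i) (yy j))"

definition start :: nat where
  "start = (LEAST i. yy i \<in> Ps)"

lemma sepD:
  assumes "new i" shows "G i \<le> sep G i" "j < i \<Longrightarrow> \<not> agr (sep G i) (yy j) (yy i)"
proof -
  have "\<exists>n. \<forall>j\<in>{..<i}. \<not> agr n (yy j) (yy i)"
    by (rule ex_not_agr_finite) (use assms in \<open>simp_all add: new_def\<close>)
  then obtain n where n: "\<And>j. j < i \<Longrightarrow> \<not> agr n (yy j) (yy i)" by blast
  have "\<not> agr (max n (G i)) (yy j) (yy i)" if "j < i" for j
    using n[OF that] agr_mono[of "max n (G i)" "yy j" "yy i" n] by auto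
  then have "\<exists>n. G i \<le> n \<and> (\<forall>j<i. \<not> agr n (yy j) (yy i))"
    by (intro exI[of _ "max n (G i)"]) simp
  then have "G i \<le> sep G i \<and> (\<forall>j<i. \<not> agr (sep G i) (yy j) (yy i))"
    unfolding sep_def by (rule LeastI_ex)
  then show "G i \<le> sep G i" "j < i \<Longrightarrow> \<not> agr (sep G i) (yy j) (yy i)" by blast+
qed

lemma branchD:
  assumes "yy i \<in> Ps" shows "B \<le> branch i B" "\<exists>v\<in>Ps. dif (branch i B) (yy i) v"
proof -
  obtain v where v: "v \<in> Ps" "v \<noteq> yy i" "agr B (yy i) v" using perfect[OF assms] by blast
  then obtain m where m: "dif m (yy i) v" using ex_dif[of "yy i" v] by auto
  have "B \<le> m" using v(3) dif_agr_iff[OF m] by simp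
  then have "\<exists>m. B \<le> m \<and> (\<exists>v\<in>Ps. dif m (yy i) v)" using m v by blast
  then have "B \<le> branch i B \<and> (\<exists>v\<in>Ps. dif (branch i B) (yy i) v)"
    unfolding branch_def by (rule LeastI_ex)
  then show "B \<le> branch i B" "\<exists>v\<in>Ps. dif (branch i B) (yy i) v" by blast+
qed

text \<open>The departure level is at least \<open>sep G i\<close>, where \<open>yy i\<close> has
  already split from all earlier terms, so the new index must be larger. In turn the new term is
  separated from \<open>yy i\<close> only above the departure, which will make departure levels
  increase.\<close>

lemma nxtD:
  assumes "good i" "sep G i \<le> B"
  shows "dif (branch i B) (yy i) (yy (nxt i B))" "good (nxt i B)" "i < nxt i B"
    "branch i B < sep H (nxt i B)"
proof -
  let ?m = "branch i B" and ?j = "nxt i B"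
  obtain v where v: "v \<in> Ps" "dif ?m (yy i) v" using branchD(2)[of i B] assms by (auto simp: good_def)
  \<comment> \<open>Level \<open>Suc ?m\<close> instead of \<open>?m\<close> also copies the bit at
    which \<open>v\<close> leaves \<open>yy i\<close>.\<close>
  obtain j where "yy j \<in> Ps" "agr (Suc ?m) v (yy j)" using dense[OF v(1)] by blast
  then have "\<exists>j. yy j \<in> Ps \<and> dif ?m (yy i) (yy j)"
    using v(2) agr_trans[of ?m "yy i" v "yy j"] by (intro exI[of _ j]) (simp add: dif_def agr_Suc)
  from LeastI_ex[OF this] have j: "yy ?j \<in> Ps" and dif: "dif ?m (yy i) (yy ?j)"
    by (auto simp: nxt_def)
  show "dif ?m (yy i) (yy ?j)" by fact
  have "new ?j" unfolding new_def
  proof (intro allI impI)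
    fix k assume "k < ?j"
    then have "\<not> (yy k \<in> Ps \<and> dif ?m (yy i) (yy k))" unfolding nxt_def by (rule not_less_Least)
    then show "yy k \<noteq> yy ?j" using j dif by auto
  qed
  then show good: "good ?j" using j by (simp add: good_def)
  have ne: "yy i \<noteq> yy ?j" using dif by (auto simp: dif_def)
  have "\<not> ?j < i"
  proof
    assume "?j < i"
    then have "\<not> agr (sep G i) (yy ?j) (yy i)" using sepD assms by (auto simp: good_def)
    moreover have "sep G i \<le> ?m" using branchD(1)[of i B] assms by (auto simp: good_def)
    ultimately show False using dif_agr_iff[OF dif] by (simp add: agr_sym[of _ "yy ?j"])
  qed
  then show "i < ?j" using ne by (metis linorder_neqE_nat)
  then have "\<not> agr (sep H ?j) (yy i) (yy ?j)" using sepD good by (auto simp: good_def)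
  then show "?m < sep H ?j" using dif_agr_iff[OF dif] by simp
qed

lemma good_start: "good start"
proof -
  have "\<exists>i. yy i \<in> Ps" using nonempty dense by blast
  then have "yy start \<in> Ps" unfolding start_def by (rule LeastI_ex)
  moreover have "yy j \<notin> Ps" if "j < start" for j
    using that not_less_Least unfolding start_def by blast
  ultimately show ?thesis unfolding good_def new_def by metis
qed

text \<open>Departure levels increase strictly, so every later term agrees with
  \<open>yy (c k)\<close> up to the departure from it. The diagonal \<open>x\<close> is their limit
  and leaves \<open>yy (c k)\<close> at exactly the same level as the next term does.\<close>

lemma chain:
  assumes c0: "good (c 0)" and B: "\<And>k. sep G (c k) \<le> B k"
    and c: "\<And>k. c (Suc k) = nxt (c k) (B k)"
  defines "x \<equiv> \<lambda>n. yy (c (Suc n)) n"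
  shows "good (c k)" "c k < c (Suc k)" "dif (branch (c k) (B k)) x (yy (c k))" "agr k x (yy (c k))"
proof -
  let ?m = "\<lambda>k. branch (c k) (B k)"
  have good: "good (c k)" for k
    by (induction k) (simp_all add: c0 c nxtD(2)[OF _ B])
  then show "good (c k)" .
  show "c k < c (Suc k)" using nxtD(3)[OF good B] c by simp
  have d: "dif (?m k) (yy (c k)) (yy (c (Suc k)))" for k using nxtD(1)[OF good B] c by simp
  have m: "?m k < ?m (Suc k)" for k
  proof -
    have "?m k < sep G (c (Suc k))" using nxtD(4)[OF good B] c by simp
    also have "\<dots> \<le> ?m (Suc k)" using B branchD(1) good order_trans unfolding good_def by blast
    finally show ?thesis .
  qed
  then have smono: "strict_mono ?m" by (simp add: strict_mono_Suc_iff)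
  have later: "agr (?m k) (yy (c (k + l))) (yy (c k))" for k l
  proof (induction l)
    case (Suc l)
    have "agr (?m (k + l)) (yy (c (k + l))) (yy (c (Suc (k + l))))" using d by (simp add: dif_def)
    moreover have "?m k \<le> ?m (k + l)" using strict_mono_less_eq[OF smono, of k "k + l"] by simp
    ultimately show ?case using Suc agr_mono agr_sym agr_trans by (metis add_Suc_right)
  qed simp
  have later': "agr (?m k) (yy (c l)) (yy (c k))" if "k \<le> l" for k l
    using later[of k "l - k"] that by simp
  have lim: "agr (?m k) x (yy (c k))" for k
    unfolding agr_def
  proof (intro allI impI)
    fix n assume n: "n < ?m k"
    let ?l = "max k (Suc n)"
    \<comment> \<open>A strictly increasing sequence of naturals dominates its index, so bit
      \<open>n\<close> is settled from term \<open>Suc n\<close> on; this justifies the diagonal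
      definition of \<open>x\<close>.\<close>
    have "n < ?m (Suc n)" using strict_mono_imp_increasing[OF smono, of "Suc n"] by simp
    then have "yy (c ?l) n = yy (c (Suc n)) n" using later'[of "Suc n" ?l] by (simp add: agr_def)
    moreover have "yy (c ?l) n = yy (c k) n" using later'[of k ?l] n by (simp add: agr_def)
    ultimately show "x n = yy (c k) n" by (simp add: x_def)
  qed
  then have "x (?m k) = yy (c (Suc k)) (?m k)" using lim[of "Suc k"] m by (auto simp: agr_def)
  with lim d show "dif (?m k) x (yy (c k))" by (auto simp: dif_def)
  show "agr k x (yy (c k))"
    using lim[of k] strict_mono_imp_increasing[OF smono, of k] agr_mono by blast
qed

end

context transitive_model
begin

section \<open>Reals of a transitive model\<close>

lemma bit_real_graph: assumes "elems x = real_graph u" shows "bit x = u"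
proof
  fix n
  have "bit x n \<longleftrightarrow> pair (num n) (num 1) \<in> real_graph u"
    using assms by (auto simp: bit_def elems_def)
  also have "\<dots> \<longleftrightarrow> u n"
    by (auto simp: real_graph_def pair_inject num_closed num_inject image_iff)
  finally show "bit x n = u n" .
qed

lemma elems_2: "elems (num 2) = {num 0, num 1}"
  by (simp add: elems_num numeral_2_eq_2 lessThan_Suc insert_commute)

text \<open>Absoluteness: apart from \<open>x \<in> M\<close> the right side is independent of the
  model, so a real of \<open>V\<close> lying in \<open>W\<close> is a real of
  \<open>W\<close>.\<close>

lemma reals_iff: "x \<in> reals M \<longleftrightarrow> x \<in> M \<and> elems x = real_graph (bit x)"
proof
  assume "x \<in> reals M"
  then obtain w t where x: "x \<in> M" and w: "w \<in> M" "is_omega M w" and t: "t \<in> M" "is_two M t"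
    and f: "is_function M x w t" by (auto simp: reals_def)
  have el: "elems w = range num" "elems t = {num 0, num 1}"
    using w t is_omega_iff is_two_iff elems_2 by auto
  have 1: "\<exists>n b. p = pair (num n) (num (of_bool b))" if "p \<in> elems x" for p
  proof -
    have "p \<in> M" "p \<^bold>\<in> x" using that elems_subset x by (auto simp: elems_def)
    with f obtain a b where "a \<in> M" "b \<in> M" "a \<in> elems w" "b \<in> elems t" "is_pair M a b p"
      unfolding is_function_def elems_def by blast
    then have "p = pair a b" "a \<in> range num" "b = num (of_bool False) \<or> b = num (of_bool True)"
      using el \<open>p \<in> M\<close> by (auto simp: is_pair_iff)
    then show ?thesis by blast
  qed
  have 2: "\<exists>!b. b \<in> M \<and> pair (num n) b \<in> elems x" for n
  proof -
    have "num n \<^bold>\<in> w" using el by (auto simp: elems_def)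
    then have "\<exists>!b. b \<in> M \<and> maps_to M x (num n) b" using f num_closed by (auto simp: is_function_def)
    then show ?thesis by (simp add: maps_to_iff num_closed elems_def cong: conj_cong)
  qed
  have 3: "pair (num n) (num (of_bool b)) \<in> elems x \<longleftrightarrow> b = bit x n" for n b
  proof -
    obtain c where c: "c \<in> M" "pair (num n) c \<in> elems x" using 2 by blast
    then obtain b' where "c = num (of_bool b')" using 1[OF c(2)] by (auto simp: pair_inject num_closed)
    with c have b': "pair (num n) (num (of_bool b')) \<in> elems x" by simp
    then have *: "pair (num n) (num (of_bool b)) \<in> elems x \<longleftrightarrow> b = b'" for b
      using 2[of n] by (metis num_closed num_inject of_bool_eq_iff)
    have "bit x n \<longleftrightarrow> pair (num n) (num (of_bool True)) \<in> elems x" by (simp add: bit_def elems_def)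
    then have "bit x n = b'" using *[of True] by blast
    with *[of b] show ?thesis by blast
  qed
  have "elems x = real_graph (bit x)"
  proof (intro equalityI subsetI)
    fix p assume p: "p \<in> elems x"
    then obtain n b where nb: "p = pair (num n) (num (of_bool b))" using 1 by blast
    then have "b = bit x n" using p 3 by blast
    with nb show "p \<in> real_graph (bit x)" unfolding real_graph_def by blast
  next
    fix p assume "p \<in> real_graph (bit x)"
    then obtain n where "p = pair (num n) (num (of_bool (bit x n)))" unfolding real_graph_def by blast
    then show "p \<in> elems x" using 3 by blast
  qed
  with x show "x \<in> M \<and> elems x = real_graph (bit x)" by simp
next
  assume x: "x \<in> M \<and> elems x = real_graph (bit x)"
  let ?w = "cod (range num)"
  have w: "?w \<in> M" "is_omega M ?w" "elems ?w = range num"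
    using represented_omega representedD is_omega_iff by auto
  have pr: "pair (num n) b \<^bold>\<in> x \<longleftrightarrow> b = num (of_bool (bit x n))" if "b \<in> M" for n b
  proof -
    have "pair (num n) b \<^bold>\<in> x \<longleftrightarrow> pair (num n) b \<in> real_graph (bit x)" using x by (auto simp: elems_def)
    also have "\<dots> \<longleftrightarrow> b = num (of_bool (bit x n))"
      using that by (auto simp: real_graph_def pair_inject num_closed num_inject)
    finally show ?thesis .
  qed
  have "is_function M x ?w (num 2)" unfolding is_function_def
  proof (intro conjI ballI impI)
    fix p assume p: "p \<in> M" "p \<^bold>\<in> x"
    then have "p \<in> real_graph (bit x)" using x by (auto simp: elems_def)
    then obtain n where n: "p = pair (num n) (num (of_bool (bit x n)))" by (auto simp: real_graph_def)
    have "num n \<^bold>\<in> ?w" "num (of_bool (bit x n)) \<^bold>\<in> num 2"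
      by (simp_all add: represented_mem[OF represented_omega] num_mem_num)
    then show "\<exists>a\<in>M. \<exists>b\<in>M. a \<^bold>\<in> ?w \<and> b \<^bold>\<in> num 2 \<and> is_pair M a b p"
      using n p num_closed is_pair_iff by blast
  next
    fix a assume "a \<in> M" "a \<^bold>\<in> ?w"
    then obtain n where n: "a = num n" using w by (auto simp: elems_def)
    show "\<exists>!b. b \<in> M \<and> maps_to M x a b"
      unfolding n by (rule ex1I[of _ "num (of_bool (bit x n))"]) (auto simp: maps_to_iff pr num_closed)
  qed
  then show "x \<in> reals M"
    using x w num_closed is_two_iff by (auto simp: reals_def)
qed

lemma has_pred_bit: "x \<in> M \<Longrightarrow> has_pred M (bit x)"
  by (intro has_predI definable_intros)

lemma represented_real: assumes "has_pred M u" shows "represented (real_graph u)"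
proof -
  let ?R = "{pair x y |x y. x \<in> range num \<and> y \<in> elems (num 2) \<and> y = num (if u (numof x) then 1 else 0)}"
  have "represented ?R"
    by (intro represented_graph represented_omega represented_elems num_closed definable_intros has_predD[OF assms])
  also have "?R = real_graph u"
    by (force simp: real_graph_def elems_2 numof_num)
  finally show ?thesis .
qed

lemma real_of_pred:
  assumes "has_pred M u" shows "cod (real_graph u) \<in> reals M" "bit (cod (real_graph u)) = u"
  using representedD[OF represented_real[OF assms]] bit_real_graph by (auto simp: reals_iff)

lemma reals_eqI: "x \<in> reals M \<Longrightarrow> y \<in> reals M \<Longrightarrow> bit x = bit y \<Longrightarrow> x = y"
  by (metis reals_iff elems_inject)

lemma agree_below_iff:
  assumes "x \<in> reals M" "y \<in> reals M"
  shows "agree_below M (num n) x y \<longleftrightarrow> agr n (bit x) (bit y)"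
proof -
  have pr: "maps_to M z (num k) v \<longleftrightarrow> v = num (of_bool (bit z k))" if "z \<in> reals M" "v \<in> M" for z v k
  proof -
    have "maps_to M z (num k) v \<longleftrightarrow> pair (num k) v \<in> real_graph (bit z)"
      using that by (auto simp: maps_to_iff num_closed reals_iff elems_def)
    also have "\<dots> \<longleftrightarrow> v = num (of_bool (bit z k))"
      using that by (auto simp: real_graph_def pair_inject num_closed num_inject)
    finally show ?thesis .
  qed
  have "agree_below M (num n) x y \<longleftrightarrow> (\<forall>k\<in>elems (num n). \<exists>v\<in>M. maps_to M x k v \<and> maps_to M y k v)"
    unfolding agree_below_def using elems_subset[OF num_closed] by (auto simp: elems_def)
  also have "\<dots> \<longleftrightarrow> (\<forall>k<n. num (of_bool (bit x k)) = num (of_bool (bit y k)))"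
    unfolding elems_num using pr assms num_closed by auto
  also have "\<dots> \<longleftrightarrow> agr n (bit x) (bit y)" by (auto simp: agr_def num_inject)
  finally show ?thesis .
qed

text \<open>Closedness inside \<open>M\<close> speaks only of points of \<open>M\<close>. This is
  why every limit taken later must first be shown to be definable in \<open>V\<close>.\<close>

lemma perfect_inD:
  assumes P: "P \<in> M" "perfect_in M P"
  shows "elems P \<subseteq> reals M" "elems P \<noteq> {}"
    and "has_pred M u \<Longrightarrow> (\<And>n. \<exists>v\<in>bit ` elems P. agr n u v) \<Longrightarrow> u \<in> bit ` elems P"
    and "v \<in> bit ` elems P \<Longrightarrow> \<exists>w\<in>bit ` elems P. w \<noteq> v \<and> agr n v w"
proof -
  show sub: "elems P \<subseteq> reals M" using assms elems_subset by (auto simp: perfect_in_def elems_def)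
  show "elems P \<noteq> {}" using assms by (auto simp: perfect_in_def elems_def)
  from P(2)[unfolded perfect_in_def] obtain w where w: "w \<in> M" "is_omega M w"
    and cl: "\<forall>x\<in>reals M. (\<forall>n\<in>M. n \<^bold>\<in> w \<longrightarrow> (\<exists>y\<in>M. y \<^bold>\<in> P \<and> agree_below M n x y)) \<longrightarrow> x \<^bold>\<in> P"
    and pf: "\<forall>x\<in>M. x \<^bold>\<in> P \<longrightarrow>
      (\<forall>n\<in>M. n \<^bold>\<in> w \<longrightarrow> (\<exists>y\<in>M. y \<^bold>\<in> P \<and> y \<noteq> x \<and> agree_below M n x y))"
    by (elim conjE bexE) (rule that)
  have el: "elems w = range num" by (rule is_omegaD[OF w])
  show "u \<in> bit ` elems P" if u: "has_pred M u" and n: "\<And>n. \<exists>v\<in>bit ` elems P. agr n u v"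
  proof -
    let ?x = "cod (real_graph u)"
    have "?x \<^bold>\<in> P"
    proof (rule cl[THEN bspec, THEN mp]; (intro ballI impI)?)
      show "?x \<in> reals M" using real_of_pred u by blast
      fix m assume "m \<in> M" "m \<^bold>\<in> w"
      then obtain k where k: "m = num k" using el by (auto simp: elems_def)
      obtain y where "y \<in> elems P" "agr k u (bit y)" using n by blast
      moreover from this have "y \<in> M" "y \<in> reals M" using sub elems_subset[OF P(1)] by blast+
      ultimately show "\<exists>y\<in>M. y \<^bold>\<in> P \<and> agree_below M m ?x y"
        using agree_below_iff[OF real_of_pred(1)[OF u], of y k] real_of_pred(2)[OF u]
        unfolding k elems_def by auto
    qed
    then have "?x \<in> elems P" by (simp add: elems_def)
    then show ?thesis using real_of_pred(2)[OF u] by (metis imageI)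
  qed
  show "\<exists>w\<in>bit ` elems P. w \<noteq> v \<and> agr n v w" if v: "v \<in> bit ` elems P"
  proof -
    obtain x where x: "x \<in> elems P" "v = bit x" using v by blast
    have "num n \<^bold>\<in> w" using el by (auto simp: elems_def)
    moreover have "x \<in> M" "x \<^bold>\<in> P" using x elems_subset[OF P(1)] by (auto simp: elems_def)
    ultimately obtain y where y: "y \<^bold>\<in> P" "y \<noteq> x" "agree_below M (num n) x y"
      using pf num_closed by blast
    then have "y \<in> elems P" "y \<in> reals M" "x \<in> reals M" using sub x by (auto simp: elems_def)
    then show ?thesis using y x agree_below_iff reals_eqI by blast
  qed
qed

end

section \<open>Covering a countable dense subset\<close>

text \<open>The reflexive lexicographic order on the first \<open>k\<close> bits, with
  \<open>False\<close> before \<open>True\<close>.\<close>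

definition lexle :: "nat \<Rightarrow> (nat \<Rightarrow> bool) \<Rightarrow> (nat \<Rightarrow> bool) \<Rightarrow> bool" where
  "lexle k u v \<longleftrightarrow> agr k u v \<or> (\<exists>j. j < k \<and> agr j u v \<and> \<not> u j \<and> v j)"

lemma lexle_antisym: "lexle k u v \<Longrightarrow> lexle k v u \<Longrightarrow> agr k u v"
  unfolding lexle_def agr_def by (metis linorder_neqE_nat)

lemma lexle_mono: "lexle n u v \<Longrightarrow> k \<le> n \<Longrightarrow> lexle k u v"
  unfolding lexle_def by (meson agr_mono dual_order.trans not_less)

lemma lexle_agr: "agr k w u \<Longrightarrow> lexle k u v \<Longrightarrow> lexle k w v"
  unfolding lexle_def agr_def by (metis order_less_trans)

text \<open>Extend a minimal word bit by bit, choosing \<open>False\<close> whenever some member of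
  \<open>S\<close> with the same word allows it.\<close>

lemma ex_lexle_least:
  assumes "u \<in> S" shows "\<exists>w\<in>S. \<forall>v\<in>S. lexle k w v"
proof (induction k)
  case 0
  then show ?case using assms by (auto simp: lexle_def agr_def)
next
  case (Suc k)
  then obtain w where w: "w \<in> S" "\<And>v. v \<in> S \<Longrightarrow> lexle k w v" by blast
  have "\<exists>w'\<in>S. agr k w' w \<and> (w' k \<longrightarrow> (\<forall>v\<in>S. agr k v w \<longrightarrow> v k))"
  proof (cases "\<exists>w'\<in>S. agr k w' w \<and> \<not> w' k")
    case False
    with w(1) show ?thesis by (intro bexI[of _ w]) auto
  qed blast
  then obtain w' where w': "w' \<in> S" "agr k w' w" "w' k \<Longrightarrow> v \<in> S \<Longrightarrow> agr k v w \<Longrightarrow> v k" for v by blast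
  have "lexle (Suc k) w' v" if "v \<in> S" for v
  proof -
    have "lexle k w' v" using lexle_agr w'(2) w(2) that by blast
    then consider "agr k w' v" | j where "j < k" "agr j w' v" "\<not> w' j" "v j"
      unfolding lexle_def by blast
    then show ?thesis
    proof cases
      case 1
      then have "agr k v w" using w'(2) agr_sym agr_trans by blast
      then show ?thesis using 1 w'(3)[OF _ that] unfolding lexle_def agr_Suc by (metis lessI)
    next
      case 2
      then show ?thesis unfolding lexle_def using less_SucI by blast
    qed
  qed
  with w'(1) show ?case by blast
qed

text \<open>The binary number with a leading 1 followed by the first \<open>n\<close> bits; the
  leading 1 makes the length recoverable. The form with \<open>rec_nat\<close> and sums suits
  \<open>defnat_rec\<close>.\<close>

definition code :: "(nat \<Rightarrow> bool) \<Rightarrow> nat \<Rightarrow> nat" where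
  "code u n = rec_nat (Suc 0) (\<lambda>k s. if u k then Suc (s + s) else s + s) n"

lemma code_pos: "code u n > 0"
  by (induction n) (auto simp: code_def)

lemma code_Suc: "code u (Suc n) = (if u n then Suc (2 * code u n) else 2 * code u n)"
  by (simp add: code_def)

lemma code_0: "code u 0 = 1"
  by (simp add: code_def)

lemma code_inject: "code u n = code v m \<Longrightarrow> n = m \<and> agr n u v"
proof (induction n arbitrary: m)
  case 0
  then show ?case using code_pos[of v "m - 1"]
    by (cases m) (auto simp: code_0 code_Suc agr_def split: if_splits)
next
  case (Suc n)
  show ?case
  proof (cases m)
    case 0
    then show ?thesis using Suc.prems code_pos[of u n] by (auto simp: code_0 code_Suc split: if_splits)
  next
    case (Suc m')
    have "u n = v m' \<and> code u n = code v m'"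
      using Suc.prems unfolding Suc code_Suc by (auto split: if_splits) presburger+
    then show ?thesis using Suc.IH[of m'] Suc by (auto simp: agr_Suc)
  qed
qed

locale covering_pair = set_universe mem + W: transitive_model mem W + V: transitive_model mem V
  for mem :: "'u \<Rightarrow> 'u \<Rightarrow> bool"  (infix "\<^bold>\<in>" 50) and W V :: "'u set" +
  fixes P :: 'u
  assumes W_sub_V: "W \<subseteq> V" and P_in: "P \<in> V" and P_perfect: "perfect_in V P"
    and P_sub_W: "elems P \<subseteq> W" and covering: "countable_covering_reals W V"
begin

definition Ps :: "(nat \<Rightarrow> bool) set" where
  "Ps = bit ` elems P"

lemma Ps_in_W: "u \<in> Ps \<Longrightarrow> has_pred W u"
  using P_sub_W W.has_pred_bit by (auto simp: Ps_def)

lemma Ps_closed: "has_pred V u \<Longrightarrow> (\<And>n. \<exists>v\<in>Ps. agr n u v) \<Longrightarrow> u \<in> Ps"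
  unfolding Ps_def by (rule V.perfect_inD(3)[OF P_in P_perfect])

lemma Ps_perfect: "u \<in> Ps \<Longrightarrow> \<exists>v\<in>Ps. v \<noteq> u \<and> agr n u v"
  unfolding Ps_def by (rule V.perfect_inD(4)[OF P_in P_perfect])

lemma Ps_nonempty: "Ps \<noteq> {}"
  using V.perfect_inD(2)[OF P_in P_perfect] by (simp add: Ps_def)

text \<open>Stated for \<open>V\<close> because \<open>P \<in> V\<close> serves as the parameter;
  definitions meant for \<open>W\<close> have to avoid \<open>Ps\<close>.\<close>

lemma definable_Ps:
  assumes "V.definable (\<lambda>a. Q (bit (a 0)) (\<lambda>i. a (Suc i)))"
  shows "V.definable (\<lambda>a. \<exists>u\<in>Ps. Q u a)" "V.definable (\<lambda>a. \<forall>u\<in>Ps. Q u a)"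
  unfolding Ps_def bex_simps ball_simps by (intro V.definable_intros assms P_in)+

text \<open>A point of \<open>Ps\<close> with this property is determined by its first
  \<open>n\<close> bits, so over all \<open>n\<close> there are only countably many, in a way that
  \<open>V\<close> can see.\<close>

definition leftmost :: "nat \<Rightarrow> (nat \<Rightarrow> bool) \<Rightarrow> bool" where
  "leftmost n w \<longleftrightarrow> (\<forall>v\<in>Ps. agr n w v \<longrightarrow> (\<forall>k. lexle k w v))"

text \<open>Members of the cone that are least on their first \<open>K\<close> bits all share these
  bits; \<open>b\<close> is the limit of such members, and closedness puts it into
  \<open>Ps\<close>.\<close>

lemma ex_leftmost: assumes "u \<in> Ps" shows "\<exists>b\<in>Ps. agr n u b \<and> leftmost n b"
proof -
  define S where "S = {v \<in> Ps. agr n u v}"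
  \<comment> \<open>Written with \<open>Ps\<close> instead of \<open>S\<close> so that the
    definability rules apply; bit \<open>k\<close> is decided by minimality on \<open>Suc k\<close>
    bits.\<close>
  define b where "b = (\<lambda>k. \<exists>w\<in>Ps. agr n u w \<and> (\<forall>v\<in>Ps. agr n u v \<longrightarrow> lexle (Suc k) w v) \<and> w k)"
  have b: "b k \<longleftrightarrow> (\<exists>w\<in>S. (\<forall>v\<in>S. lexle (Suc k) w v) \<and> w k)" for k
    by (auto simp: b_def S_def)
  have u: "u \<in> S" "has_pred V u" using assms Ps_in_W has_mono(1)[OF W_sub_V] by (auto simp: S_def)
  have agree: "agr K b w" if "w \<in> S" "\<forall>v\<in>S. lexle K w v" for K w
    unfolding agr_def
  proof (intro allI impI)
    fix j assume "j < K"
    then have w: "\<forall>v\<in>S. lexle (Suc j) w v" using that lexle_mono Suc_leI by blast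
    have "w' j = w j" if "w' \<in> S" "\<forall>v\<in>S. lexle (Suc j) w' v" for w'
      using lexle_antisym[of "Suc j" w' w] that w \<open>w \<in> S\<close> by (auto simp: agr_Suc)
    then show "b j = w j" unfolding b using \<open>w \<in> S\<close> w by blast
  qed
  have ex: "\<exists>w\<in>S. (\<forall>v\<in>S. lexle K w v) \<and> agr K b w" for K
    using ex_lexle_least[OF u(1), of K] agree by blast
  have "has_pred V b"
    unfolding b_def lexle_def agr_def
    by (intro V.has_predI definable_Ps V.definable_intros V.has_predD[OF u(2)])
  then have "b \<in> Ps"
    by (rule Ps_closed) (use ex in \<open>auto simp: S_def\<close>)
  moreover have ub: "agr n u b"
    using ex[of n] agr_trans agr_sym unfolding S_def by blast
  moreover have "leftmost n b" unfolding leftmost_def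
  proof (intro ballI impI allI)
    fix v k assume "v \<in> Ps" "agr n b v"
    then have "v \<in> S" using ub agr_trans by (auto simp: S_def)
    then show "lexle k b v" using ex[of k] lexle_agr by blast
  qed
  ultimately show ?thesis by blast
qed

text \<open>Covering is applied to the eventually leftmost points, which are dense by
  \<open>ex_leftmost\<close> and are counted in \<open>V\<close> by coding the word that determines
  each of them.\<close>

lemma ex_enumeration:
  obtains yy where "has_rel W yy" "\<And>u n. u \<in> Ps \<Longrightarrow> \<exists>i. yy i \<in> Ps \<and> agr n u (yy i)"
proof -
  \<comment> \<open>Using the least level assigns a single word, hence a single code, to each
    point.\<close>
  define lv where "lv = (\<lambda>x. LEAST n. leftmost n (bit x))"
  define X where "X = {x \<in> elems P. \<exists>n. leftmost n (bit x)}"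
  define f where "f = {pair x y |x y. x \<in> X \<and> y \<in> range num \<and> y = num (code (bit x) (lv x))}"
  have sub: "X \<subseteq> elems P" "X \<subseteq> V" "X \<subseteq> reals V"
    using P_in V.elems_subset V.perfect_inD(1)[OF P_in P_perfect] by (auto simp: X_def)
  have X: "V.represented X" unfolding X_def leftmost_def lexle_def agr_def
    by (intro V.represented_sep V.represented_elems P_in definable_Ps V.definable_intros)
  have f: "V.represented f" unfolding f_def lv_def code_def leftmost_def lexle_def agr_def
    by (intro V.represented_graph X V.represented_omega definable_Ps V.definable_intros V.defnat_rec)
  \<comment> \<open>Equal codes mean the same level and the same word; each point is then leftmost
    in a cone containing the other, and antisymmetry identifies them.\<close>
  have inj: "x = y" if "x \<in> X" "y \<in> X" "code (bit x) (lv x) = code (bit y) (lv y)" for x y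
  proof -
    have "leftmost (lv z) (bit z)" if "z \<in> X" for z
      unfolding lv_def by (rule LeastI_ex) (use that in \<open>simp add: X_def\<close>)
    with that have "leftmost (lv x) (bit x)" "leftmost (lv y) (bit y)" by blast+
    moreover have "bit x \<in> Ps" "bit y \<in> Ps" using that sub by (auto simp: Ps_def)
    moreover have "lv x = lv y" "agr (lv x) (bit x) (bit y)" using code_inject that(3) by blast+
    ultimately have "lexle k (bit x) (bit y)" "lexle k (bit y) (bit x)" for k
      unfolding leftmost_def by (simp_all add: agr_sym[of _ "bit y"])
    then have "agr (Suc k) (bit x) (bit y)" for k using lexle_antisym by blast
    then have "bit x = bit y" by (simp add: agr_Suc fun_eq_iff)
    then show ?thesis using V.reals_eqI sub that by blast
  qed
  have f_mem: "p \<^bold>\<in> cod f \<longleftrightarrow> (\<exists>x\<in>X. p = pair x (num (code (bit x) (lv x))))" for p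
    unfolding V.represented_mem[OF f] unfolding f_def by auto
  have maps: "maps_to V (cod f) x b \<longleftrightarrow> x \<in> X \<and> b = num (code (bit x) (lv x))"
    if x: "x \<in> V" and b: "b \<in> V" for x b
  proof -
    have "pair x b = pair y (num (code (bit y) (lv y))) \<longleftrightarrow> x = y \<and> b = num (code (bit y) (lv y))"
      if "y \<in> X" for y
      using V.pair_inject[OF x b, of y] that sub V.num_closed by blast
    then show ?thesis unfolding V.maps_to_iff[OF x b] f_mem by blast
  qed
  let ?w = "cod (range num)"
  have w: "?w \<in> V" "is_omega V ?w" "elems ?w = range num"
    using V.representedD[OF V.represented_omega] V.is_omega_iff by auto
  have "is_injection V (cod f) (cod X) ?w" unfolding is_injection_def is_function_def
  proof (intro conjI ballI impI)
    fix p assume "p \<in> V" "p \<^bold>\<in> cod f"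
    then obtain x where x: "x \<in> X" "p = pair x (num (code (bit x) (lv x)))"
      unfolding f_mem by blast
    have "num (code (bit x) (lv x)) \<^bold>\<in> ?w" "x \<^bold>\<in> cod X" "x \<in> V"
      using x sub by (auto simp: V.represented_mem[OF X] V.represented_mem[OF V.represented_omega])
    then show "\<exists>a\<in>V. \<exists>b\<in>V. a \<^bold>\<in> cod X \<and> b \<^bold>\<in> ?w \<and> is_pair V a b p"
      using V.is_pair_iff[of x _ p] V.num_closed \<open>p \<in> V\<close> x(2) by blast
  next
    fix x assume x: "x \<in> V" "x \<^bold>\<in> cod X"
    then have "x \<in> X" by (simp add: V.represented_mem[OF X])
    then show "\<exists>!b. b \<in> V \<and> maps_to V (cod f) x b"
      using maps[OF x(1)] V.num_closed by blast
  next
    fix x y b assume xy: "x \<in> V" "y \<in> V" "b \<in> V" "maps_to V (cod f) x b \<and> maps_to V (cod f) y b"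
    then have "x \<in> X" "y \<in> X" "num (code (bit x) (lv x)) = num (code (bit y) (lv y))"
      using maps[of x b] maps[of y b] by auto
    then show "x = y" using inj by (simp add: V.num_inject)
  qed
  then have "countable_in V (cod X)"
    using w(1,2) V.represented_cod[OF f] unfolding countable_in_def by blast
  have "x \<in> reals W" if "x \<in> X" for x
  proof -
    have "x \<in> W" "x \<in> reals V" using that sub P_sub_W by blast+
    then show ?thesis by (simp only: V.reals_iff W.reals_iff)
  qed
  then have "elems (cod X) \<subseteq> reals W" using V.representedD[OF X] by blast
  then have "\<exists>Y\<in>W. elems (cod X) \<subseteq> elems Y \<and> countable_in W Y"
    using \<open>countable_in V (cod X)\<close> covering[unfolded countable_covering_reals_def, rule_format, OF V.represented_cod[OF X]]
    by blast
  then obtain Y where Y: "Y \<in> W" "X \<subseteq> elems Y" "countable_in W Y"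
    using V.representedD[OF X] by auto
  then obtain w g where w: "w \<in> W" "is_omega W w" and g: "g \<in> W" "is_injection W g Y w"
    unfolding countable_in_def by blast
  note g_inj = g(2)[unfolded is_injection_def is_function_def]
  note g_range = g_inj[THEN conjunct1, THEN conjunct1, rule_format]
    and g_total = g_inj[THEN conjunct1, THEN conjunct2, rule_format]
    and g_inj = g_inj[THEN conjunct2, rule_format]
  \<comment> \<open>Reads the injection \<open>g\<close> backwards; an index outside its range gives
    the constantly \<open>False\<close> sequence.\<close>
  define yy where "yy = (\<lambda>i n. \<exists>y\<in>elems Y. pair y (num i) \<^bold>\<in> g \<and> bit y n)"
  have "has_rel W yy" unfolding yy_def
    by (intro W.has_relI W.definable_intros W.defterm_pair Y g)
  moreover have "\<exists>i. yy i \<in> Ps \<and> agr n u (yy i)" if u: "u \<in> Ps" for u n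
  proof -
    obtain b where b: "b \<in> Ps" "agr n u b" "leftmost n b" using ex_leftmost[OF u] by blast
    then obtain x where x: "x \<in> X" "b = bit x" by (auto simp: X_def Ps_def)
    then have xY: "x \<in> W" "x \<^bold>\<in> Y" using Y W.elems_subset by (auto simp: elems_def)
    then obtain c where c: "c \<in> W" "maps_to W g x c"
      using g_total[of x] by blast
    have xc: "pair x c \<in> W" using xY c W.pair_closed by blast
    have xcg: "pair x c \<^bold>\<in> g" using c xY W.maps_to_iff by blast
    obtain a d where ad: "a \<in> W" "d \<in> W" "d \<^bold>\<in> w" "is_pair W a d (pair x c)"
      using g_range[OF xc xcg] by blast
    then have "pair x c = pair a d" using xc by (simp add: W.is_pair_iff)
    then have "c \<^bold>\<in> w" using W.pair_inject[of x c a d] xY c ad by simp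
    then obtain i where i: "c = num i" using W.is_omegaD[OF w] by (auto simp: elems_def)
    have uniq: "y = x" if "y \<in> elems Y" "pair y (num i) \<^bold>\<in> g" for y
    proof -
      have "y \<in> W" using that Y W.elems_subset by blast
      then have "maps_to W g y c" using that W.maps_to_iff c i by blast
      then show ?thesis using g_inj[of y x c] c xY \<open>y \<in> W\<close> by blast
    qed
    have "x \<in> elems Y" using xY by (simp add: elems_def)
    then have "yy i n \<longleftrightarrow> bit x n" for n
      using uniq xcg i unfolding yy_def by blast
    then have "yy i = bit x" by blast
    then show ?thesis using b x by (intro exI[of _ i]) simp
  qed
  ultimately show ?thesis by (rule that)
qed

end

section \<open>Domination and coding\<close>

lemma strict_incseq_bracket:
  fixes c :: "nat \<Rightarrow> nat"
  assumes "\<And>k. c k < c (Suc k)" "c 0 \<le> i"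
  obtains k where "c k \<le> i" "i < c (Suc k)"
proof -
  have "Suc i \<le> c (Suc i)"
    using assms(1) by (intro strict_mono_imp_increasing) (simp add: strict_mono_Suc_iff)
  then have ex: "\<exists>n. i < c n" by (intro exI[of _ "Suc i"]) simp
  define n where "n = (LEAST n. i < c n)"
  have n: "i < c n" unfolding n_def by (rule LeastI_ex[OF ex])
  then obtain k where k: "n = Suc k" using assms(2) by (cases n) auto
  then have "\<not> i < c k" unfolding n_def using not_less_Least[of k "\<lambda>n. i < c n"] by simp
  then show thesis using n k by (intro that[of k]) simp_all
qed

locale covering_enumeration = covering_pair +
  fixes yy :: "nat \<Rightarrow> nat \<Rightarrow> bool"
  assumes yy_W: "has_rel W yy" and yy_dense: "u \<in> Ps \<Longrightarrow> \<exists>i. yy i \<in> Ps \<and> agr n u (yy i)"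
begin

sublocale dense_enumeration Ps yy
  by unfold_locales (use Ps_perfect yy_dense Ps_nonempty in auto)

lemma yy_V: "has_rel V yy"
  by (rule has_mono(2)[OF W_sub_V yy_W])

lemma definable_yy_Ps: assumes "V.defnat t" shows "V.definable (\<lambda>a. yy (t a) \<in> Ps)"
proof -
  have "yy i \<in> Ps \<longleftrightarrow> (\<exists>u\<in>Ps. \<forall>n. u n = yy i n)" for i
    by (auto simp: fun_eq_iff[symmetric])
  then show ?thesis
    by (simp only:) (intro definable_Ps V.definable_intros V.has_relD[OF yy_V] V.defterm_rename[OF assms])
qed

lemma defnat_branch:
  assumes "V.defnat i" "V.defnat B" shows "V.defnat (\<lambda>a. branch (i a) (B a))"
  unfolding branch_def dif_def agr_def
  by (intro definable_Ps V.definable_intros V.has_relD[OF yy_V] assms[THEN V.defterm_rename])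

lemma defnat_nxt:
  assumes "V.defnat i" "V.defnat B" shows "V.defnat (\<lambda>a. nxt (i a) (B a))"
  unfolding nxt_def dif_def agr_def
  by (intro definable_yy_Ps V.definable_intros V.has_relD[OF yy_V] defnat_branch assms[THEN V.defterm_rename])

lemma defnat_sep_V:
  assumes "has_fun V G" "V.defnat i" shows "V.defnat (\<lambda>a. sep G (i a))"
  unfolding sep_def agr_def
  by (intro V.definable_intros V.has_relD[OF yy_V] V.has_funD[OF assms(1)] assms(2)[THEN V.defterm_rename])

lemma defnat_sep_W:
  assumes "has_fun W G" "W.defnat i" shows "W.defnat (\<lambda>a. sep G (i a))"
  unfolding sep_def agr_def
  by (intro W.definable_intros W.has_relD[OF yy_W] W.has_funD[OF assms(1)] assms(2)[THEN W.defterm_rename])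

lemma chain_limit_in_Ps:
  assumes "has_fun V c" "\<And>k. good (c k)" "\<And>k. agr k (\<lambda>n. yy (c (Suc n)) n) (yy (c k))"
  shows "(\<lambda>n. yy (c (Suc n)) n) \<in> Ps"
proof (rule Ps_closed)
  show "has_pred V (\<lambda>n. yy (c (Suc n)) n)"
    by (intro V.has_predI V.has_relD[OF yy_V] V.has_funD[OF assms(1)] V.definable_intros)
  show "\<exists>v\<in>Ps. agr k (\<lambda>n. yy (c (Suc n)) n) v" for k
    using assms(2,3)[of k] unfolding good_def by blast
qed

text \<open>Computed from \<open>x\<close> and \<open>yy\<close> alone, hence available in
  \<open>W\<close> for each \<open>x\<close> in \<open>W\<close>. Terms equal to \<open>x\<close>
  are exempted, since the sequence may contain \<open>x\<close>.\<close>

definition closeness :: "(nat \<Rightarrow> bool) \<Rightarrow> nat \<Rightarrow> nat" where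
  "closeness x k = (LEAST h. \<forall>i. i \<le> k \<longrightarrow> (\<exists>n. x n \<noteq> yy i n) \<longrightarrow> \<not> agr h x (yy i))"

lemma closeness_greater: assumes "i \<le> k" "dif m x (yy i)" shows "m < closeness x k"
proof -
  have "\<exists>h. \<forall>i\<in>{i. i \<le> k \<and> (\<exists>n. x n \<noteq> yy i n)}. \<not> agr h x (yy i)"
    by (rule ex_not_agr_finite) (auto simp: fun_eq_iff)
  then have "\<exists>h. \<forall>i. i \<le> k \<longrightarrow> (\<exists>n. x n \<noteq> yy i n) \<longrightarrow> \<not> agr h x (yy i)" by blast
  then have "\<forall>i. i \<le> k \<longrightarrow> (\<exists>n. x n \<noteq> yy i n) \<longrightarrow> \<not> agr (closeness x k) x (yy i)"
    unfolding closeness_def by (rule LeastI_ex)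
  then have "\<not> agr (closeness x k) x (yy i)" using assms unfolding dif_def by blast
  then show ?thesis by (simp add: dif_agr_iff[OF assms(2)])
qed

lemma has_fun_closeness: "has_pred W x \<Longrightarrow> has_fun W (closeness x)"
  unfolding closeness_def agr_def
  by (intro W.has_funI W.definable_intros W.has_relD[OF yy_W] W.has_predD)

text \<open>Two points of the perfect set are built along the sequence \<open>yy\<close>, each one leaving its current
  term only after agreeing with it up to the value of \<open>g\<close> at the index to which the other one has
  moved; the intervals of indices guarded by the two points cover almost all of \<open>\<omega>\<close>.\<close>

lemma dominated:
  assumes "has_fun V g" shows "\<exists>h. has_fun W h \<and> (\<forall>k. g k \<le> h k)"
proof -
  \<comment> \<open>Partial sums give a monotone majorant, so a bound at a larger index also serves
    smaller ones.\<close>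
  define gm where "gm = (\<lambda>k. rec_nat (g 0) (\<lambda>k s. s + g (Suc k)) k)"
  have gm: "has_fun V gm" unfolding gm_def
    by (intro V.has_funI V.defnat_rec V.definable_intros V.has_funD[OF assms])
  have g_le: "g k \<le> gm k" for k by (cases k) (simp_all add: gm_def)
  have "gm k \<le> gm (Suc k)" for k by (simp add: gm_def)
  then have gm_mono: "m \<le> n \<Longrightarrow> gm m \<le> gm n" for m n by (rule lift_Suc_mono_le)
  define sp where "sp = sep (\<lambda>_. 0)"
  have sp: "V.defnat (\<lambda>a. sp (t a))" if "V.defnat t" for t
    unfolding sp_def by (intro defnat_sep_V V.has_funI V.definable_intros that)
  \<comment> \<open>The move of a point now following term \<open>a\<close> while the other follows
    \<open>b\<close>: the sum is above both the separation level and \<open>gm b\<close>.\<close>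
  define stp where "stp = (\<lambda>a b. nxt a (sp a + gm b))"
  have stp: "V.defnat (\<lambda>a. stp (s a) (t a))" if "V.defnat s" "V.defnat t" for s t
    unfolding stp_def by (intro defnat_nxt V.defnat_add sp V.has_funD[OF gm] that)
  \<comment> \<open>Both indices in one number; the second point moves after the first and sees its
    updated index.\<close>
  define st where "st = (\<lambda>n. rec_nat (prod_encode (start, start))
    (\<lambda>_ s. prod_encode (stp (fst (prod_decode s)) (snd (prod_decode s)),
       stp (snd (prod_decode s)) (stp (fst (prod_decode s)) (snd (prod_decode s))))) n)"
  define a where "a = (\<lambda>n. fst (prod_decode (st n)))"
  define b where "b = (\<lambda>n. snd (prod_decode (st n)))"
  have "a 0 = start" "b 0 = start"
    and a_Suc: "a (Suc n) = nxt (a n) (sp (a n) + gm (b n))"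
    and b_Suc: "b (Suc n) = nxt (b n) (sp (b n) + gm (a (Suc n)))" for n
    by (simp_all add: a_def b_def st_def stp_def)
  have st: "V.defnat (\<lambda>a. st (t a))" if "V.defnat t" for t unfolding st_def
    by (intro V.defnat_rec V.definable_intros stp that)
  have ab: "has_fun V a" "has_fun V b" unfolding a_def b_def
    by (intro V.has_funI V.definable_intros st)+
  have 0: "good (a 0)" "good (b 0)" using \<open>a 0 = start\<close> \<open>b 0 = start\<close> good_start by simp_all
  define x where "x = (\<lambda>n. yy (a (Suc n)) n)"
  define y where "y = (\<lambda>n. yy (b (Suc n)) n)"
  have le: "sep (\<lambda>_. 0) (a k) \<le> sp (a k) + gm (b k)" "sep (\<lambda>_. 0) (b k) \<le> sp (b k) + gm (a (Suc k))" for k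
    by (simp_all add: sp_def)
  note ca = chain[of a, OF 0(1) le(1) a_Suc, folded x_def]
  note cb = chain[of b, OF 0(2) le(2) b_Suc, folded y_def]
  have "x \<in> Ps" "y \<in> Ps" unfolding x_def y_def
    by (rule chain_limit_in_Ps[OF ab(1) ca(1) ca(4)[unfolded x_def]],
        rule chain_limit_in_Ps[OF ab(2) cb(1) cb(4)[unfolded y_def]])
  then have xy: "has_pred W x" "has_pred W y" using Ps_in_W by blast+
  \<comment> \<open>The sum bounds all three cases; \<open>gm start\<close> takes care of indices
    below the common starting point.\<close>
  define h where "h = (\<lambda>k. closeness x k + closeness y k + gm start)"
  have "has_fun W h" unfolding h_def
    by (intro W.has_funI W.definable_intros W.has_funD[OF has_fun_closeness] xy)
  moreover have "gm k \<le> h k" for k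
  proof (cases "start \<le> k")
    case True
    obtain n where n: "a n \<le> k" "k < a (Suc n)"
      using strict_incseq_bracket[of a k] ca(2) True \<open>a 0 = start\<close> by metis
    show ?thesis
    \<comment> \<open>For \<open>a n \<le> k \<le> b n\<close> the first point waited at
      \<open>a n\<close> up to \<open>gm (b n)\<close>; for \<open>b n < k < a (Suc n)\<close> the
      second waited at \<open>b n\<close> up to \<open>gm (a (Suc n))\<close>.\<close>
    proof (cases "k \<le> b n")
      case True
      have "gm k \<le> gm (b n)" using gm_mono True .
      also have "\<dots> \<le> branch (a n) (sp (a n) + gm (b n))"
        using branchD(1)[of "a n" "sp (a n) + gm (b n)"] ca(1)[of n] by (simp add: good_def)
      also have "\<dots> < closeness x k" using closeness_greater[OF n(1) ca(3)] .
      finally show ?thesis by (simp add: h_def)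
    next
      case False
      have "gm k \<le> gm (a (Suc n))" using gm_mono n(2) by simp
      also have "\<dots> \<le> branch (b n) (sp (b n) + gm (a (Suc n)))"
        using branchD(1)[of "b n" "sp (b n) + gm (a (Suc n))"] cb(1)[of n] by (simp add: good_def)
      also have "\<dots> < closeness y k" using closeness_greater[OF _ cb(3)] False by simp
      finally show ?thesis by (simp add: h_def)
    qed
  next
    case False
    then show ?thesis using gm_mono[of k start] by (simp add: h_def)
  qed
  ultimately show ?thesis using g_le order_trans by blast
qed

text \<open>Choosing early or late departure codes the bits of \<open>r\<close>. Since \<open>G\<close> bounds the agreement of
  points of the perfect set with terms outside it, the departures can be recognized from \<open>x\<close>
  inside \<open>W\<close>, and \<open>H\<close> separates early from late.\<close>

lemma pred_in_W: assumes r: "has_pred V r" shows "has_pred W r"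
proof -
  \<comment> \<open>For terms in \<open>Ps\<close> the implication is vacuous and the value is 0;
    for the others closedness provides a level from which no point of \<open>Ps\<close>
    agrees.\<close>
  define gl where "gl = (\<lambda>i. LEAST n. yy i \<notin> Ps \<longrightarrow> (\<forall>v\<in>Ps. \<not> agr n (yy i) v))"
  have gl: "\<not> agr (gl i) (yy i) v" if i: "yy i \<notin> Ps" and v: "v \<in> Ps" for i v
  proof -
    have "has_pred V (yy i)" by (intro V.has_predI V.has_relD[OF yy_V] V.definable_intros)
    then have "\<exists>n. yy i \<notin> Ps \<longrightarrow> (\<forall>v\<in>Ps. \<not> agr n (yy i) v)" using Ps_closed i by blast
    then have "yy i \<notin> Ps \<longrightarrow> (\<forall>v\<in>Ps. \<not> agr (gl i) (yy i) v)" unfolding gl_def by (rule LeastI_ex)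
    then show ?thesis using i v by blast
  qed
  \<comment> \<open>\<open>gl\<close> refers to \<open>Ps\<close> and so is obtained in
    \<open>V\<close>; the majorant \<open>G\<close> brings its effect into \<open>W\<close>.\<close>
  have "has_fun V gl" unfolding gl_def agr_def
    by (intro V.has_funI definable_Ps definable_yy_Ps V.definable_intros V.has_relD[OF yy_V])
  then obtain G where G: "has_fun W G" "\<And>i. gl i \<le> G i" using dominated by blast
  have GV: "has_fun V G" by (rule has_mono(3)[OF W_sub_V G(1)])
  \<comment> \<open>\<open>Suc\<close> puts the earliest departure strictly below \<open>H\<close>,
    so departures at \<open>H\<close> or later are recognizably late.\<close>
  have "has_fun V (\<lambda>i. Suc (branch i (sep G i)))"
    by (intro V.has_funI V.definable_intros defnat_branch defnat_sep_V[OF GV])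
  then obtain H where H: "has_fun W H" "\<And>i. Suc (branch i (sep G i)) \<le> H i" using dominated by blast
  have HV: "has_fun V H" by (rule has_mono(3)[OF W_sub_V H(1)])
  \<comment> \<open>Term \<open>c k\<close> is left at the first branching from
    \<open>sep G (c k)\<close> on if \<open>r k\<close> fails, and not before \<open>H (c k)\<close>
    if it holds.\<close>
  define c where "c = (\<lambda>n. rec_nat start
    (\<lambda>k s. nxt s (if r k then H s + sep G s else sep G s)) n)"
  define B where "B = (\<lambda>k. if r k then H (c k) + sep G (c k) else sep G (c k))"
  define x where "x = (\<lambda>n. yy (c (Suc n)) n)"
  have "has_fun V c" unfolding c_def
    by (intro V.has_funI V.defnat_rec defnat_nxt V.definable_intros V.has_predD[OF r]
        V.has_funD[OF HV] defnat_sep_V[OF GV])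
  have c_0: "c 0 = start" and c_Suc: "c (Suc k) = nxt (c k) (B k)" for k
    by (simp_all add: c_def B_def)
  have c_good: "good (c 0)" using good_start c_0 by simp
  have B: "sep G (c k) \<le> B k" for k by (simp add: B_def)
  note ch = chain[of c, OF c_good B c_Suc, folded x_def]
  have x: "x \<in> Ps" unfolding x_def
    by (rule chain_limit_in_Ps[OF \<open>has_fun V c\<close> ch(1) ch(4)[unfolded x_def]])
  have x_W: "has_pred W x" using Ps_in_W[OF x] .
  have m: "B k \<le> branch (c k) (B k)" for k using branchD(1) ch(1)[of k] by (simp add: good_def)
  \<comment> \<open>Refers to \<open>x\<close>, \<open>yy\<close> and \<open>G\<close> only, all of
    which \<open>W\<close> has; \<open>gen_c\<close> and \<open>gen_D\<close> show that it describes
    the range of \<open>c\<close>.\<close>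
  define gen where "gen = (\<lambda>i. (\<forall>j. j < i \<longrightarrow> (\<exists>n. yy j n \<noteq> yy i n)) \<and> agr (sep G i) x (yy i))"
  have new: "(\<forall>j. j < i \<longrightarrow> (\<exists>n. yy j n \<noteq> yy i n)) \<longleftrightarrow> new i" for i
    by (simp add: new_def fun_eq_iff)
  have gen_c: "gen (c k)" for k
    using ch(1)[of k] dif_agr_iff[OF ch(3)[of k]] order_trans[OF B m, of k]
    unfolding gen_def new good_def by blast
  have gen_D: "\<exists>k. i = c k" if i: "gen i" for i
  proof (rule ccontr)
    assume no: "\<nexists>k. i = c k"
    have ni: "new i" and ag: "agr (sep G i) x (yy i)" using i unfolding gen_def new by blast+
    have "gl i \<le> sep G i" using G(2) sepD(1)[OF ni] order_trans by blast
    then have "agr (gl i) (yy i) x" using ag agr_mono agr_sym by blast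
    then have iP: "yy i \<in> Ps" using gl x by blast
    then have "c 0 \<le> i" unfolding c_0 start_def by (rule Least_le)
    then obtain k where k: "c k \<le> i" "i < c (Suc k)" using strict_incseq_bracket ch(2) by metis
    then have "c k < i" using no by (metis le_neq_implies_less)
    then have far: "\<not> agr (sep G i) (yy (c k)) (yy i)" using sepD(2)[OF ni] by blast
    \<comment> \<open>Since \<open>yy i\<close> has split from \<open>yy (c k)\<close> below
      \<open>sep G i\<close> while \<open>x\<close> still follows \<open>yy i\<close>, both leave
      \<open>yy (c k)\<close> at level \<open>?m\<close>. Then \<open>i\<close> would be a smaller
      candidate for \<open>c (Suc k)\<close>.\<close>
    let ?m = "branch (c k) (B k)"
    have "?m < sep G i"
    proof (rule ccontr)
      assume "\<not> ?m < sep G i"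
      then have "agr (sep G i) x (yy (c k))" using dif_agr_iff[OF ch(3)[of k]] by simp
      then show False using far ag agr_sym agr_trans by blast
    qed
    then have "agr (Suc ?m) x (yy i)" using ag agr_mono Suc_leI by blast
    then have "dif ?m (yy (c k)) (yy i)"
      using ch(3)[of k] agr_sym[of ?m x "yy (c k)"] agr_trans[of ?m "yy (c k)" x "yy i"]
      unfolding dif_def agr_Suc by metis
    moreover have "\<not> (yy i \<in> Ps \<and> dif ?m (yy (c k)) (yy i))"
      using k(2) unfolding c_Suc nxt_def by (rule not_less_Least)
    ultimately show False using iP by blast
  qed
  have c_strict: "strict_mono c" using ch(2) by (simp add: strict_mono_Suc_iff)
  \<comment> \<open>As the increasing enumeration of \<open>gen\<close>, the sequence
    \<open>c\<close> is recovered inside \<open>W\<close>, although it was defined from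
    \<open>r\<close> and \<open>Ps\<close>.\<close>
  have c_W: "c n = rec_nat (LEAST i. gen i) (\<lambda>_ s. LEAST i. s < i \<and> gen i) n" for n
  proof (induction n)
    case 0
    have "(LEAST i. gen i) = c 0"
    proof (rule Least_equality)
      fix i assume "gen i"
      then obtain k where "i = c k" using gen_D by blast
      then show "c 0 \<le> i" using strict_mono_less_eq[OF c_strict, of 0 k] by simp
    qed (rule gen_c)
    then show ?case by simp
  next
    case (Suc n)
    have "(LEAST i. c n < i \<and> gen i) = c (Suc n)"
    proof (rule Least_equality)
      fix i assume i: "c n < i \<and> gen i"
      then obtain k where k: "i = c k" using gen_D by blast
      then have "n < k" using i strict_mono_less[OF c_strict, of n k] by simp
      then show "c (Suc n) \<le> i" using k strict_mono_less_eq[OF c_strict, of "Suc n" k] by simp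
    qed (use gen_c ch(2) in blast)
    then show ?case using Suc by simp
  qed
  have gen_W: "W.definable (\<lambda>a. gen (t a))" if "W.defnat t" for t
    unfolding gen_def agr_def
    by (intro W.definable_intros W.has_relD[OF yy_W] W.has_predD[OF x_W] defnat_sep_W[OF G(1)]
        W.defterm_rename[OF that])
  have c_fun: "W.defnat (\<lambda>a. c (t a))" if "W.defnat t" for t
    unfolding c_W by (intro W.defnat_rec W.definable_intros gen_W that)
  \<comment> \<open>The tested level is the waiting time \<open>B k\<close> of the case
    \<open>r k\<close>; in the other case the departure has happened below
    \<open>H (c k)\<close>.\<close>
  have r_iff: "r k \<longleftrightarrow> agr (H (c k) + sep G (c k)) x (yy (c k))" for k
  proof -
    have "branch (c k) (sep G (c k)) < H (c k)" using H(2)[of "c k"] by simp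
    then show ?thesis
      unfolding dif_agr_iff[OF ch(3)[of k]] using m[of k] by (auto simp: B_def)
  qed
  show "has_pred W r"
  proof (rule W.has_predI)
    show "W.definable (\<lambda>a. r (numof (a 0)))"
      unfolding r_iff agr_def
      by (intro W.definable_intros W.has_relD[OF yy_W]
        W.has_predD[OF x_W] c_fun defnat_sep_W[OF G(1)] W.has_funD[OF H(1)])
  qed
qed

lemma reals_eq: "reals W = reals V"
proof (intro equalityI subsetI)
  fix x assume "x \<in> reals W"
  then show "x \<in> reals V" using W_sub_V by (auto simp only: W.reals_iff V.reals_iff)
next
  fix x assume "x \<in> reals V"
  then have x: "x \<in> V" "elems x = real_graph (bit x)" by (simp_all only: V.reals_iff)
  then have "has_pred W (bit x)" by (intro pred_in_W V.has_pred_bit)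
  then have "cod (real_graph (bit x)) \<in> reals W" by (rule W.real_of_pred(1))
  then show "x \<in> reals W" using x cod_elems[of x] by simp
qed

end

theorem theorem6:
  fixes mem :: "'u \<Rightarrow> 'u \<Rightarrow> bool"
    and W V :: "'u set"
  assumes "set_universe mem"
    and "W \<subseteq> V"
    and "set_universe.transitive mem W" and "set_universe.ZFC_model mem W"
    and "set_universe.transitive mem V" and "set_universe.ZFC_model mem V"
    and "\<exists>P\<in>V. set_universe.perfect_in mem V P \<and> set_universe.elems mem P \<subseteq> W"
    and "set_universe.countable_covering_reals mem W V"
  shows "set_universe.reals mem W = set_universe.reals mem V"
proof -
  obtain P where P: "P \<in> V" "set_universe.perfect_in mem V P" "set_universe.elems mem P \<subseteq> W"
    using assms(7) by blast
  interpret covering_pair mem W V P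
    using assms P by (simp add: covering_pair_def covering_pair_axioms_def transitive_model_def
      transitive_model_axioms_def)
  obtain yy where "has_rel W yy" "\<And>u n. u \<in> Ps \<Longrightarrow> \<exists>i. yy i \<in> Ps \<and> agr n u (yy i)"
    by (rule ex_enumeration) (rule that)
  then interpret covering_enumeration mem W V P yy
    by unfold_locales
  show ?thesis by (rule reals_eq)
qed

end
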